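(* Consider a $\nu$-stage IMEX Runge-Kutta scheme with coefficients $(\tilde A,\tilde w,A,w)$ applied to $\partial_t f+v\cdot\nabla_x f=\frac1\varepsilon Q(f)$, i.e. $$F=f^n e+\Delta t\,\tilde A\,L(F)+\frac{\Delta t}{\varepsilon}A\,Q(F),\qquad f^{n+1}=f^n+\Delta t\,\tilde w^T L(F)+\frac{\Delta t}{\varepsilon}w^T Q(F),\qquad n\ge 0.$$ If the scheme is of type CK and globally stiffly accurate, then for consistent initial data $f_0$, in the limit $\varepsilon\to0$ with $\Delta t$ fixed, the scheme becomes the explicit Runge-Kutta scheme characterized by $(\tilde A,\tilde w,\tilde c)$ applied to the Euler system $\partial_t U+\nabla_x\cdot\mathcal F(U)=0$. That is, for every $n\ge0$, in the limit each stage satisfies $F^{(i)}=M[F^{(i)}]$, and with $\mathcal U^{(i)}=\langle\phi F^{(i)}\rangle$, $U^n=\langle\phi f^n\rangle$, $$\mathcal U^{(i)}=U^n-\Delta t\sum_{j=1}^{i-1}\tilde a_{ij}\nabla_x\cdot\mathcal F(\mathcal U^{(j)}),\quad i=1,\dots,\nu,\qquad U^{n+1}=U^n-\Delta t\sum_{i=1}^{\nu}\tilde w_i\nabla_x\cdot\mathcal F(\mathcal U^{(i)}).$$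
   Context: Kinetic equation: $f=f(x,v,t)\ge0$, $v\in\mathbb R^3$, $x\in\Omega\subset\mathbb R^{d_x}$, $t>0$, initial datum $f_0(x,v)$, Knudsen number $\varepsilon>0$. Notation: $\langle g\rangle=\int_{\mathbb R^3}g\,dv$, $\phi(v)=(1,v,|v|^2/2)^T$. Maxwellian: for a distribution $f$ with moments $(\rho,\rho u,E)^T=\langle\phi f\rangle$ and temperature $T=\frac1{3\rho}\langle|v-u|^2f\rangle$, $M[f]=\frac{\rho}{(2\pi T)^{3/2}}\exp\left(-\frac{|u-v|^2}{2T}\right)$, so $\langle\phi M[f]\rangle=\langle\phi f\rangle$. Assumptions on the collision operator $Q$ (acting in $v$): $\langle\phi\,Q(f)\rangle=0$ for all $f$; and $Q(f)=0$ if and only if $f=M[f]$. Euler system: $U=(\rho,\rho u,E)^T=\langle\phi M[f]\rangle$, $\mathcal F(U)=\langle v\phi M[f]\rangle=(\rho u,\rho u\otimes u+pI,Eu+pu)^T$, $p=\rho T$. Scheme: $\tilde A=(\tilde a_{ij})$, $A=(a_{ij})$ are real $\nu\times\nu$ matrices with $\tilde a_{ij}=0$ for $j\ge i$ and $a_{ij}=0$ for $j>i$; $\tilde w,w\in\mathbb R^\nu$; $\tilde c_i=\sum_j\tilde a_{ij}$; $e=(1,\dots,1)^T\in\mathbb R^\nu$; $F=(F^{(1)},\dots,F^{(\nu)})^T$ are the stages; $L(F)$ and $Q(F)$ act componentwise, with $L(F^{(i)})=-v\cdot\nabla_xF^{(i)}$; $\Delta t>0$ is the time step; $f^0=f_0$.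 Type CK: $A=\begin{pmatrix} 0 & 0 \\ a & \hat A \end{pmatrix}$ with $a=(a_{21},\dots,a_{\nu1})^T\in\mathbb R^{\nu-1}$ and $\hat A\in\mathbb R^{(\nu-1)\times(\nu-1)}$ invertible. Globally stiffly accurate (GSA): $a_{\nu i}=w_i$ and $\tilde a_{\nu i}=\tilde w_i$ for $i=1,\dots,\nu$. Consistent (well prepared) initial data: $f_0(x,v)=M[f_0(x,v)]+g^\varepsilon(x,v)$ with $\lim_{\varepsilon\to0}g^\varepsilon(x,v)=0$. Convention on limits: the limit $\varepsilon\to0$ is formal. For fixed $\Delta t$, the ($\varepsilon$-dependent) numerical quantities $f^n$ and $F^{(i)}$ are assumed to converge as $\varepsilon\to0$, and $Q$, $L$, $M[\cdot]$ and the moments $\langle\cdot\rangle$ are assumed to commute with this limit; the statement is about the limiting quantities. *)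

theory Defs
  imports "HOL-Analysis.Analysis" "Jordan_Normal_Form.Matrix"
begin

section \<open>Velocity moments and Maxwellians\<close>

text \<open>
  The vector \<open>\<phi>(v) = (1, v, |v|\<^sup>2/2)\<close> of collision invariants takes its values in the Euclidean
  space \<open>real \<times> real^3 \<times> real\<close>, which is also the type of the macroscopic states
  \<open>U = (\<rho>, \<rho>u, E)\<close>.
\<close>

type_synonym macro = "real \<times> (real ^ 3) \<times> real"

definition phi :: "real ^ 3 \<Rightarrow> macro" where
  "phi v = (1, v, (norm v)\<^sup>2 / 2)"

definition moments :: "(real ^ 3 \<Rightarrow> real) \<Rightarrow> macro" where
  "moments g = (\<integral>v. g v *\<^sub>R phi v \<partial>lborel)"

definition has_moments :: "(real ^ 3 \<Rightarrow> real) \<Rightarrow> bool" where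
  "has_moments g \<longleftrightarrow> integrable lborel (\<lambda>v. g v *\<^sub>R phi v)"

definition density :: "(real ^ 3 \<Rightarrow> real) \<Rightarrow> real" where
  "density g = fst (moments g)"

definition bulk_velocity :: "(real ^ 3 \<Rightarrow> real) \<Rightarrow> real ^ 3" where
  "bulk_velocity g = (1 / density g) *\<^sub>R fst (snd (moments g))"

definition temperature :: "(real ^ 3 \<Rightarrow> real) \<Rightarrow> real" where
  "temperature g = 1 / (3 * density g) * (\<integral>v. (norm (v - bulk_velocity g))\<^sup>2 * g v \<partial>lborel)"

definition maxwellian :: "(real ^ 3 \<Rightarrow> real) \<Rightarrow> real ^ 3 \<Rightarrow> real" where
  "maxwellian g v =
     density g / (2 * pi * temperature g) powr (3 / 2) *
       exp (- (norm (bulk_velocity g - v))\<^sup>2 / (2 * temperature g))"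

text \<open>The velocity distributions for which the Maxwellian is a meaningful expression.\<close>

definition admissible :: "(real ^ 3 \<Rightarrow> real) set" where
  "admissible = {g. has_moments g \<and> density g > 0 \<and> temperature g > 0}"

text \<open>
  A collision operator is a map on velocity distributions that conserves mass, momentum and energy
  and whose equilibria are exactly the Maxwellians. Such an operator need not make sense on all
  functions of \<open>v\<close>, so these properties are required on its domain \<open>D\<close> only, for instance on a class
  of nonnegative functions with enough decay.
\<close>

definition collision_operator ::
    "(real ^ 3 \<Rightarrow> real) set \<Rightarrow> ((real ^ 3 \<Rightarrow> real) \<Rightarrow> real ^ 3 \<Rightarrow> real) \<Rightarrow> bool" where
  "collision_operator D Q \<longleftrightarrow>
     D \<subseteq> admissible \<and>
     (\<forall>g\<in>D. has_moments (Q g) \<and> moments (Q g) = 0) \<and>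
     (\<forall>g\<in>D. (\<forall>v. Q g v = 0) \<longleftrightarrow> g = maxwellian g)"

section \<open>Transport and the Euler flux\<close>

definition partial ::
    "'d \<Rightarrow> (real ^ 'd \<Rightarrow> 'b) \<Rightarrow> real ^ 'd \<Rightarrow> 'b :: real_normed_vector" where
  "partial k h x = frechet_derivative h (at x) (axis k 1)"

text \<open>
  Positions live in \<open>real ^ 'd\<close> and velocities in \<open>real ^ 3\<close>. The map \<open>\<iota>\<close> tells which velocity component
  transports along which position axis, so that \<open>v \<bullet> \<nabla>\<^sub>x\<close> is the sum over \<open>k\<close> of
  \<open>v\<close> at \<open>\<iota> k\<close> times the \<open>k\<close>-th partial derivative. It is meant to be injective;
  for \<open>'d = 3\<close> it can be taken to be the identity.
\<close>

definition transport ::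
    "('d::finite \<Rightarrow> 3) \<Rightarrow> (real ^ 'd \<Rightarrow> real ^ 3 \<Rightarrow> real) \<Rightarrow> real ^ 'd \<Rightarrow> real ^ 3 \<Rightarrow> real" where
  "transport \<iota> g x v = - (\<Sum>k\<in>UNIV. v $ \<iota> k * partial k (\<lambda>y. g y v) x)"

text \<open>
  Regularity which the transport term and its moments presuppose.
\<close>

definition transportable ::
    "(real ^ 'd) set \<Rightarrow> ('d::finite \<Rightarrow> 3) \<Rightarrow> (real ^ 'd \<Rightarrow> real ^ 3 \<Rightarrow> real) \<Rightarrow> bool" where
  "transportable \<Omega> \<iota> g \<longleftrightarrow>
     (\<forall>x\<in>\<Omega>. (\<forall>v. (\<lambda>y. g y v) differentiable (at x)) \<and> has_moments (transport \<iota> g x))"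

text \<open>
  The pressure is \<open>p = \<rho>T\<close>, and \<open>3\<rho>T = \<langle>|v - u|\<^sup>2 f\<rangle> = 2E - \<rho>|u|\<^sup>2\<close> expresses it
  through the conserved variables \<open>(\<rho>, m, E)\<close> with \<open>m = \<rho>u\<close>.
\<close>

fun pressure :: "macro \<Rightarrow> real" where
  "pressure (\<rho>, m, E) = (2 * E - \<rho> * (norm ((1 / \<rho>) *\<^sub>R m))\<^sup>2) / 3"

text \<open>
  The column of the flux \<open>(\<rho>u, \<rho>u \<otimes> u + pI, Eu + pu)\<close> that belongs to the direction \<open>j\<close>.
\<close>

fun euler_flux :: "3 \<Rightarrow> macro \<Rightarrow> macro" where
  "euler_flux j (\<rho>, m, E) =
     (let u = (1 / \<rho>) *\<^sub>R m; p = pressure (\<rho>, m, E) in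
      (\<rho> * u $ j, (\<rho> * u $ j) *\<^sub>R u + p *\<^sub>R axis j 1, E * u $ j + p * u $ j))"

definition div_flux ::
    "('d::finite \<Rightarrow> 3) \<Rightarrow> (real ^ 'd \<Rightarrow> macro) \<Rightarrow> real ^ 'd \<Rightarrow> macro" where
  "div_flux \<iota> U x = (\<Sum>k\<in>UNIV. partial k (\<lambda>y. euler_flux (\<iota> k) (U y)) x)"

definition flux_differentiable ::
    "('d::finite \<Rightarrow> 3) \<Rightarrow> (real ^ 'd \<Rightarrow> macro) \<Rightarrow> real ^ 'd \<Rightarrow> bool" where
  "flux_differentiable \<iota> U x \<longleftrightarrow> (\<forall>k. (\<lambda>y. euler_flux (\<iota> k) (U y)) differentiable (at x))"

section \<open>IMEX Runge-Kutta schemes\<close>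

text \<open>Stages are numbered \<open>0, \<dots>, \<nu> - 1\<close>.\<close>

definition imex_tableau ::
    "nat \<Rightarrow> real mat \<Rightarrow> real Matrix.vec \<Rightarrow> real mat \<Rightarrow> real Matrix.vec \<Rightarrow> bool" where
  "imex_tableau \<nu> At wt A w \<longleftrightarrow>
     At \<in> carrier_mat \<nu> \<nu> \<and> wt \<in> carrier_vec \<nu> \<and> A \<in> carrier_mat \<nu> \<nu> \<and> w \<in> carrier_vec \<nu> \<and>
     (\<forall>i<\<nu>. \<forall>j<\<nu>. j \<ge> i \<longrightarrow> At $$ (i, j) = 0) \<and>
     (\<forall>i<\<nu>. \<forall>j<\<nu>. j > i \<longrightarrow> A $$ (i, j) = 0)"

definition type_CK :: "nat \<Rightarrow> real mat \<Rightarrow> bool" where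
  "type_CK \<nu> A \<longleftrightarrow>
     (\<exists>a Ahat. a \<in> carrier_mat (\<nu> - 1) 1 \<and> Ahat \<in> carrier_mat (\<nu> - 1) (\<nu> - 1) \<and>
        invertible_mat Ahat \<and>
        A = four_block_mat (0\<^sub>m 1 1) (0\<^sub>m 1 (\<nu> - 1)) a Ahat)"

definition globally_stiffly_accurate ::
    "nat \<Rightarrow> real mat \<Rightarrow> real Matrix.vec \<Rightarrow> real mat \<Rightarrow> real Matrix.vec \<Rightarrow> bool" where
  "globally_stiffly_accurate \<nu> At wt A w \<longleftrightarrow>
     (\<forall>i<\<nu>. A $$ (\<nu> - 1, i) = w $ i \<and> At $$ (\<nu> - 1, i) = wt $ i)"

text \<open>
  One step from \<open>fn\<close> to \<open>fnew\<close> with stages \<open>F 0, \<dots>, F (\<nu> - 1)\<close> of the scheme for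
  the kinetic equation with Knudsen number \<open>\<epsilon>\<close>.
\<close>

definition imex_step ::
    "(real ^ 'd::finite) set \<Rightarrow> ('d \<Rightarrow> 3) \<Rightarrow> ((real ^ 3 \<Rightarrow> real) \<Rightarrow> real ^ 3 \<Rightarrow> real) \<Rightarrow>
     nat \<Rightarrow> real mat \<Rightarrow> real Matrix.vec \<Rightarrow> real mat \<Rightarrow> real Matrix.vec \<Rightarrow> real \<Rightarrow> real \<Rightarrow>
     (real ^ 'd \<Rightarrow> real ^ 3 \<Rightarrow> real) \<Rightarrow> (nat \<Rightarrow> real ^ 'd \<Rightarrow> real ^ 3 \<Rightarrow> real) \<Rightarrow>
     (real ^ 'd \<Rightarrow> real ^ 3 \<Rightarrow> real) \<Rightarrow> bool" where
  "imex_step \<Omega> \<iota> Q \<nu> At wt A w \<Delta>t \<epsilon> fn F fnew \<longleftrightarrow>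
     (\<forall>x\<in>\<Omega>. \<forall>v.
        (\<forall>i<\<nu>. F i x v =
           fn x v + \<Delta>t * (\<Sum>j<\<nu>. At $$ (i, j) * transport \<iota> (F j) x v)
                  + \<Delta>t / \<epsilon> * (\<Sum>j<\<nu>. A $$ (i, j) * Q (F j x) v)) \<and>
        fnew x v =
           fn x v + \<Delta>t * (\<Sum>i<\<nu>. wt $ i * transport \<iota> (F i) x v)
                  + \<Delta>t / \<epsilon> * (\<Sum>i<\<nu>. w $ i * Q (F i x) v))"

definition consistent_initial_data ::
    "(real ^ 'd::finite) set \<Rightarrow> (real \<Rightarrow> real ^ 'd \<Rightarrow> real ^ 3 \<Rightarrow> real) \<Rightarrow> bool" where
  "consistent_initial_data \<Omega> f0 \<longleftrightarrow>
     (\<exists>g. \<forall>x\<in>\<Omega>. \<forall>v.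
        (\<forall>\<epsilon>>0. f0 \<epsilon> x v = maxwellian (f0 \<epsilon> x) v + g \<epsilon> x v) \<and>
        ((\<lambda>\<epsilon>. g \<epsilon> x v) \<longlongrightarrow> 0) (at_right 0))"

text \<open>
  One step of the explicit Runge-Kutta scheme with matrix \<open>At\<close> and weights \<open>wt\<close> for the Euler
  system \<open>\<partial>\<^sub>t U + \<nabla>\<^sub>x \<bullet> \<F>(U) = 0\<close>. The abscissae do not enter because
  the system is autonomous. The first condition makes the divergences meaningful:
  the Frechet derivative of a function that is not differentiable is an unspecified value.
\<close>

definition explicit_euler_step ::
    "(real ^ 'd::finite) set \<Rightarrow> ('d \<Rightarrow> 3) \<Rightarrow> nat \<Rightarrow> real mat \<Rightarrow> real Matrix.vec \<Rightarrow> real \<Rightarrow>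
     (real ^ 'd \<Rightarrow> macro) \<Rightarrow> (nat \<Rightarrow> real ^ 'd \<Rightarrow> macro) \<Rightarrow> (real ^ 'd \<Rightarrow> macro) \<Rightarrow> bool" where
  "explicit_euler_step \<Omega> \<iota> \<nu> At wt \<Delta>t Uold Ust Unew \<longleftrightarrow>
     (\<forall>x\<in>\<Omega>.
        (\<forall>i<\<nu>. flux_differentiable \<iota> (Ust i) x) \<and>
        (\<forall>i<\<nu>. Ust i x = Uold x - \<Delta>t *\<^sub>R (\<Sum>j<i. At $$ (i, j) *\<^sub>R div_flux \<iota> (Ust j) x)) \<and>
        Unew x = Uold x - \<Delta>t *\<^sub>R (\<Sum>i<\<nu>. wt $ i *\<^sub>R div_flux \<iota> (Ust i) x))"

section \<open>The formal limit\<close>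

text \<open>Pointwise convergence in phase space as \<open>\<epsilon>\<close> tends to zero.\<close>

definition kinetic_limit ::
    "(real ^ 'd::finite) set \<Rightarrow> (real \<Rightarrow> real ^ 'd \<Rightarrow> real ^ 3 \<Rightarrow> real) \<Rightarrow>
     (real ^ 'd \<Rightarrow> real ^ 3 \<Rightarrow> real) \<Rightarrow> bool" where
  "kinetic_limit \<Omega> g glim \<longleftrightarrow>
     (\<forall>x\<in>\<Omega>. \<forall>v. ((\<lambda>\<epsilon>. g \<epsilon> x v) \<longlongrightarrow> glim x v) (at_right 0))"

definition moment_limit ::
    "(real ^ 'd::finite) set \<Rightarrow> (real \<Rightarrow> real ^ 'd \<Rightarrow> real ^ 3 \<Rightarrow> real) \<Rightarrow>
     (real ^ 'd \<Rightarrow> real ^ 3 \<Rightarrow> real) \<Rightarrow> bool" where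
  "moment_limit \<Omega> g glim \<longleftrightarrow>
     (\<forall>x\<in>\<Omega>. ((\<lambda>\<epsilon>. moments (g \<epsilon> x)) \<longlongrightarrow> moments (glim x)) (at_right 0))"

end

theory Submission
  imports Defs "HOL-Probability.Distributions"
begin

text \<open>
  In the limit the scheme forces every stage to be a local Maxwellian, and for Maxwellians the moment
  equations close.

  Multiplying the stage equations by \<open>\<epsilon>\<close> and letting \<open>\<epsilon>\<close> tend to zero leaves \<open>A Q(F) = 0\<close>
  (lemma \<open>stiff_term_limit_eq_0\<close>). For type CK the matrix \<open>A\<close> is singular: its first row vanishes,
  so this says nothing about the first stage. But the first stage equals \<open>f\<^sup>n\<close>, and if \<open>f\<^sup>n\<close>
  is a Maxwellian, then \<open>Q\<close> vanishes on the first stage and invertibility of the block \<open>Ahat\<close>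
  gives \<open>Q(F) = 0\<close> on all others (lemma \<open>type_CK_kernel\<close>). For \<open>n = 0\<close> the Maxwellian property is
  consistency of the initial data; it passes from \<open>n\<close> to \<open>n + 1\<close> because, by global stiff
  accuracy, \<open>f\<^bsup>n+1\<^esup>\<close> is the last stage.

  The moments of the collision terms vanish for every \<open>\<epsilon>\<close>, so the limit of the moment equations is
  an explicit Runge-Kutta step whose right-hand side is the moment of the transport term
  (lemma \<open>imex_step_moments\<close>). The analytic part is to identify this right-hand side with
  \<open>- \<nabla>\<^sub>x \<bullet> \<F>(U)\<close>, including differentiability of the flux, given only that \<open>F\<close> is
  differentiable in \<open>x\<close> for each fixed \<open>v\<close> (lemma \<open>moments_transport_maxwellian\<close>). It rests on
  writing a Maxwellian as \<open>exp (p \<bullet> phi v)\<close>. The logarithms at seven velocities determine \<open>p\<close>, so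
  \<open>p\<close> is differentiable in \<open>x\<close>; integrals of \<open>exp (p \<bullet> phi v)\<close> against polynomially bounded weights
  are differentiable in \<open>p\<close> under the integral sign (lemma \<open>has_derivative_exp_family_integral\<close>); and
  the integral of \<open>v\<^sub>j * phi v\<close> against a Maxwellian is the Euler flux of its moments, by rotational
  symmetry (lemma \<open>maxwellian_flux\<close>).
\<close>

text \<open>The dot is reserved for the inner product of Euclidean spaces.\<close>

no_notation Matrix.scalar_prod (infix "\<bullet>" 70)

section \<open>Gaussians as an exponential family\<close>

text \<open>
  The norm of \<open>phi v\<close> is a polynomial in \<open>v\<close> that also occurs inside \<open>p \<bullet> phi v\<close>, at
  \<open>p = (1, 0, 1)\<close>. This is why bounds below are stated in powers of \<open>norm (phi v)\<close>: an extra
  factor \<open>exp (d * norm (phi v))\<close> only shifts the parameter \<open>p\<close>.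
\<close>

lemma norm_phi: "norm (phi v) = 1 + (norm v)\<^sup>2 / 2"
proof -
  have "1 + ((norm v)\<^sup>2 + ((norm v)\<^sup>2 / 2)\<^sup>2) = (1 + (norm v)\<^sup>2 / 2)\<^sup>2"
    by (simp add: power2_eq_square algebra_simps)
  then show ?thesis
    by (simp add: phi_def norm_Pair)
qed

lemma norm_le_norm_phi: "norm v \<le> norm (phi v)"
proof -
  have "0 \<le> (norm v - 1)\<^sup>2" by simp
  then show ?thesis by (simp add: norm_phi power2_diff)
qed

lemma borel_measurable_phi [measurable]: "phi \<in> borel_measurable borel"
proof -
  have "phi = (\<lambda>v. (1, v, (norm v)\<^sup>2 / 2))"
    by (simp add: fun_eq_iff phi_def)
  also have "\<dots> \<in> borel_measurable borel"
    by (intro borel_measurable_continuous_onI continuous_intros) auto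
  finally show ?thesis .
qed

lemma inner_phi: "p \<bullet> phi v = fst p + fst (snd p) \<bullet> v + snd (snd p) * (norm v)\<^sup>2 / 2"
  by (cases p) (simp add: phi_def)

text \<open>
  By Tonelli the integral is a product of one-dimensional Gaussian integrals, since
  \<open>exp (- c * |v|\<^sup>2)\<close> factors over the coordinates.
\<close>

lemma integrable_gaussian:
  fixes c :: real
  assumes "c > 0"
  shows "integrable lborel (\<lambda>v::'a::euclidean_space. exp (- c * (norm v)\<^sup>2))"
proof -
  have base: "integrable lborel (\<lambda>x::real. exp (- x\<^sup>2))"
    using has_bochner_integral_even_function[OF gaussian_moment_0]
    by (auto simp: has_bochner_integral_iff)
  have one: "integrable lborel (\<lambda>x::real. exp (- c * x\<^sup>2))"
    using lborel_integrable_real_affine[OF base, of "sqrt c" 0] assms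
    by (simp add: power_mult_distrib)
  have "(\<integral>\<^sup>+v. ennreal (exp (- c * (norm v)\<^sup>2)) \<partial>(lborel::'a measure))
      = (\<integral>\<^sup>+v. (\<Prod>b\<in>Basis. ennreal (exp (- c * (v \<bullet> b)\<^sup>2))) \<partial>(lborel::'a measure))"
  proof (intro nn_integral_cong)
    fix v :: 'a
    have "exp (- c * (norm v)\<^sup>2) = (\<Prod>b\<in>Basis. exp (- c * (v \<bullet> b)\<^sup>2))"
      by (subst euclidean_inner[of v v, folded power2_norm_eq_inner])
         (simp add: exp_sum[symmetric] sum_distrib_left sum_negf power2_eq_square)
    then show "ennreal (exp (- c * (norm v)\<^sup>2)) = (\<Prod>b\<in>Basis. ennreal (exp (- c * (v \<bullet> b)\<^sup>2)))"
      by (simp add: prod_ennreal)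
  qed
  also have "\<dots> = (\<Prod>b\<in>(Basis::'a set). (\<integral>\<^sup>+x. ennreal (exp (- c * x\<^sup>2)) \<partial>lborel))"
    by (rule nn_integral_lborel_prod) auto
  also have "\<dots> < \<infinity>"
    using one[THEN integrableD(2)] by (auto simp: power_less_top_ennreal less_top)
  finally show ?thesis
    by (intro integrableI_bounded) auto
qed

text \<open>
  A negative last component of \<open>p\<close> makes the quadratic term win over the linear one, by
  completing the square.
\<close>

lemma integrable_exp_family:
  assumes "snd (snd p) < 0"
  shows "integrable lborel (\<lambda>v. exp (p \<bullet> phi v))"
proof -
  define c where "c = - snd (snd p) / 4"
  have "c > 0" using assms by (simp add: c_def)
  define K where "K = fst p + (norm (fst (snd p)))\<^sup>2 / (4 * c)"
  have bound: "p \<bullet> phi v \<le> K - c * (norm v)\<^sup>2" for v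
  proof -
    \<comment> \<open>half of the quadratic decay absorbs the linear term\<close>
    have "0 \<le> (norm (fst (snd p)) / (2 * sqrt c) - sqrt c * norm v)\<^sup>2" by simp
    also have "\<dots> = (norm (fst (snd p)))\<^sup>2 / (4 * c) + c * (norm v)\<^sup>2 - norm (fst (snd p)) * norm v"
      using \<open>c > 0\<close> by (simp add: power2_diff power_mult_distrib power_divide)
    finally have "fst (snd p) \<bullet> v \<le> (norm (fst (snd p)))\<^sup>2 / (4 * c) + c * (norm v)\<^sup>2"
      using norm_cauchy_schwarz[of "fst (snd p)" v] by linarith
    then show ?thesis
      by (simp add: inner_phi K_def c_def)
  qed
  have "integrable lborel (\<lambda>v::real^3. exp K * exp (- c * (norm v)\<^sup>2))"
    by (intro integrable_mult_right integrable_gaussian \<open>c > 0\<close>)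
  then show ?thesis
    by (rule Bochner_Integration.integrable_bound)
       (use bound in \<open>auto simp: exp_add[symmetric]\<close>)
qed

text \<open>
  A power of \<open>norm (phi v)\<close> is dominated by \<open>exp (d * norm (phi v))\<close>, and for small \<open>d\<close> the
  shifted parameter still belongs to an integrable member of the family.
\<close>

lemma integrable_exp_family_weight:
  fixes W :: "real^3 \<Rightarrow> 'b::euclidean_space"
  assumes p: "snd (snd p) < 0" and [measurable]: "W \<in> borel_measurable borel"
    and W: "\<And>v. norm (W v) \<le> C * norm (phi v) ^ n"
  shows "integrable lborel (\<lambda>v. exp (p \<bullet> phi v) *\<^sub>R W v)"
proof -
  define d where "d = - snd (snd p) / 2"
  have "d > 0" using p by (simp add: d_def)
  define K where "K = \<bar>C\<bar> * (fact n / d ^ n)"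
  have power_le_exp: "s ^ n \<le> fact n / d ^ n * exp (d * s)" if "s \<ge> 0" for s
  proof -
    have "(d * s) ^ n / fact n \<le> exp (d * s)"
      using sum_le_suminf[OF summable_exp[of "d * s"], of "{n}"] that \<open>d > 0\<close>
      by (simp add: exp_def divide_inverse mult.commute)
    then show ?thesis using \<open>d > 0\<close> by (simp add: field_simps power_mult_distrib)
  qed
  have "integrable lborel (\<lambda>v. K * exp ((p + d *\<^sub>R (1, 0, 1)) \<bullet> phi v))"
    using p by (intro integrable_mult_right integrable_exp_family) (simp add: d_def)
  then show ?thesis
  proof (rule Bochner_Integration.integrable_bound)
    have "norm (exp (p \<bullet> phi v) *\<^sub>R W v) \<le> norm (K * exp ((p + d *\<^sub>R (1, 0, 1)) \<bullet> phi v))" for v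
    proof -
      have "norm (W v) \<le> \<bar>C\<bar> * norm (phi v) ^ n"
        using W[of v] by (smt (verit) mult_right_mono norm_ge_zero zero_le_power)
      also have "\<dots> \<le> K * exp (d * norm (phi v))"
        unfolding K_def mult.assoc by (intro mult_left_mono power_le_exp) auto
      finally have "exp (p \<bullet> phi v) * norm (W v) \<le> exp (p \<bullet> phi v) * (K * exp (d * norm (phi v)))"
        by simp
      also have "\<dots> = K * exp ((p + d *\<^sub>R (1, 0, 1)) \<bullet> phi v)"
        by (simp add: exp_add inner_add_left norm_phi) (simp add: phi_def algebra_simps)
      finally show ?thesis using \<open>d > 0\<close> by (simp add: K_def)
    qed
    then show "AE v in lborel. norm (exp (p \<bullet> phi v) *\<^sub>R W v)
        \<le> norm (K * exp ((p + d *\<^sub>R (1, 0, 1)) \<bullet> phi v))" by simp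
  qed measurable
qed

lemma integrable_exp_family_derivative:
  fixes W :: "real^3 \<Rightarrow> 'b::euclidean_space"
  assumes p: "snd (snd p) < 0" and [measurable]: "W \<in> borel_measurable borel"
    and W: "\<And>v. norm (W v) \<le> C * norm (phi v) ^ n"
  shows "integrable lborel (\<lambda>v. ((q \<bullet> phi v) * exp (p \<bullet> phi v)) *\<^sub>R W v)"
proof -
  have "integrable lborel (\<lambda>v. exp (p \<bullet> phi v) *\<^sub>R ((q \<bullet> phi v) *\<^sub>R W v))"
  proof (rule integrable_exp_family_weight)
    fix v
    have "norm ((q \<bullet> phi v) *\<^sub>R W v) \<le> (norm q * norm (phi v)) * (C * norm (phi v) ^ n)"
      unfolding norm_scaleR real_norm_def
      by (intro mult_mono Cauchy_Schwarz_ineq2 W) auto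
    then show "norm ((q \<bullet> phi v) *\<^sub>R W v) \<le> (norm q * C) * norm (phi v) ^ Suc n"
      by (simp add: mult_ac)
  qed (use p in auto)
  then show ?thesis by (simp add: mult.commute)
qed

text \<open>
  Differentiation under the integral sign in all parameters at once. From
  \<open>|e\<^sup>t - 1 - t| \<le> t\<^sup>2 e\<^bsup>|t|\<^esup>\<close> with \<open>t = q \<bullet> phi v\<close>, the remainder for an increment
  \<open>q\<close> with \<open>norm q < d\<close> is at most \<open>K * (norm q)\<^sup>2\<close>, where the constant \<open>K\<close> is the integral of
  another member of the family with a polynomially bounded weight.
\<close>

lemma has_derivative_exp_family_integral:
  fixes W :: "real^3 \<Rightarrow> 'b::euclidean_space"
  assumes p: "snd (snd p) < 0" and [measurable]: "W \<in> borel_measurable borel"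
    and W: "\<And>v. norm (W v) \<le> C * norm (phi v) ^ n"
  shows "((\<lambda>p. \<integral>v. exp (p \<bullet> phi v) *\<^sub>R W v \<partial>lborel) has_derivative
          (\<lambda>q. \<integral>v. ((q \<bullet> phi v) * exp (p \<bullet> phi v)) *\<^sub>R W v \<partial>lborel)) (at p)"
proof -
  \<comment> \<open>parameters within distance \<open>d\<close> of \<open>p\<close> keep a negative last component\<close>
  define d where "d = - snd (snd p) / 2"
  have "d > 0" using p by (simp add: d_def)
  let ?R = "\<lambda>v. exp ((p + d *\<^sub>R (1, 0, 1)) \<bullet> phi v) *\<^sub>R ((norm (phi v))\<^sup>2 * norm (W v))"
  define K where "K = (\<integral>v. ?R v \<partial>lborel)"
  have int_R: "integrable lborel ?R"
  proof (rule integrable_exp_family_weight)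
    show "norm ((norm (phi v))\<^sup>2 * norm (W v)) \<le> C * norm (phi v) ^ (2 + n)" for v
      using mult_left_mono[OF W[of v], of "(norm (phi v))\<^sup>2"]
      by (simp add: power_add power2_eq_square mult_ac)
  qed (use p in \<open>auto simp: d_def\<close>)
  have int_0: "integrable lborel (\<lambda>v. exp (p \<bullet> phi v) *\<^sub>R W v)" if "snd (snd p) < 0" for p
    using that W by (intro integrable_exp_family_weight) auto
  have int_1: "integrable lborel (\<lambda>v. ((q \<bullet> phi v) * exp (p \<bullet> phi v)) *\<^sub>R W v)" for q
    by (rule integrable_exp_family_derivative[OF p _ W]) measurable
  have lin: "bounded_linear (\<lambda>q. \<integral>v. ((q \<bullet> phi v) * exp (p \<bullet> phi v)) *\<^sub>R W v \<partial>lborel)"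
  proof -
    have "linear (\<lambda>q. \<integral>v. ((q \<bullet> phi v) * exp (p \<bullet> phi v)) *\<^sub>R W v \<partial>lborel)"
    proof (rule linearI)
      show "(\<integral>v. ((r *\<^sub>R q \<bullet> phi v) * exp (p \<bullet> phi v)) *\<^sub>R W v \<partial>lborel)
          = r *\<^sub>R (\<integral>v. ((q \<bullet> phi v) * exp (p \<bullet> phi v)) *\<^sub>R W v \<partial>lborel)" for r q
        by (subst integral_scaleR_right[symmetric]) (simp add: mult.assoc)
    qed (simp add: inner_add_left distrib_right scaleR_add_left int_1)
    then show ?thesis by (simp add: linear_conv_bounded_linear)
  qed
  have taylor: "\<bar>exp t - 1 - t\<bar> \<le> t\<^sup>2 * exp \<bar>t\<bar>" for t :: real
  proof -
    have "norm (exp (of_real t) - (1 + of_real t) :: complex) \<le> exp \<bar>t\<bar> * t\<^sup>2"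
      using Taylor_exp[of "of_real t" 1] by (simp add: power2_eq_square)
    moreover have "exp (of_real t) - (1 + of_real t) = (of_real (exp t - 1 - t) :: complex)"
      by (simp add: exp_of_real)
    ultimately show ?thesis
      by (simp only: norm_of_real) (simp add: mult.commute)
  qed
  have remainder: "norm ((\<integral>v. exp (y \<bullet> phi v) *\<^sub>R W v \<partial>lborel) - (\<integral>v. exp (p \<bullet> phi v) *\<^sub>R W v \<partial>lborel)
      - (\<integral>v. (((y - p) \<bullet> phi v) * exp (p \<bullet> phi v)) *\<^sub>R W v \<partial>lborel)) \<le> (norm (y - p))\<^sup>2 * K"
    if y: "dist y p < d" for y
  proof -
    define q where "q = y - p"
    have yq: "y = p + q" by (simp add: q_def)
    have nq: "norm q < d" using y by (simp add: q_def dist_norm)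
    have "\<bar>snd (snd q)\<bar> \<le> norm q"
      using norm_snd_le[of "snd (snd q)" "fst (snd q)"] norm_snd_le[of "snd q" "fst q"] by simp
    then have y0: "snd (snd y) < 0"
      using nq by (simp add: yq d_def)
    have "(\<integral>v. exp (y \<bullet> phi v) *\<^sub>R W v \<partial>lborel) - (\<integral>v. exp (p \<bullet> phi v) *\<^sub>R W v \<partial>lborel)
        - (\<integral>v. ((q \<bullet> phi v) * exp (p \<bullet> phi v)) *\<^sub>R W v \<partial>lborel)
      = (\<integral>v. exp (y \<bullet> phi v) *\<^sub>R W v - exp (p \<bullet> phi v) *\<^sub>R W v
             - ((q \<bullet> phi v) * exp (p \<bullet> phi v)) *\<^sub>R W v \<partial>lborel)"
      by (simp add: int_0 int_1 y0 p)
    also have "norm \<dots> \<le> (\<integral>v. (norm q)\<^sup>2 * ?R v \<partial>lborel)"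
    proof (rule Bochner_Integration.integral_norm_bound_integral)
      fix v
      let ?t = "q \<bullet> phi v"
      have t: "\<bar>?t\<bar> \<le> norm q * norm (phi v)" by (rule Cauchy_Schwarz_ineq2)
      have "exp (y \<bullet> phi v) *\<^sub>R W v - exp (p \<bullet> phi v) *\<^sub>R W v - (?t * exp (p \<bullet> phi v)) *\<^sub>R W v
          = (exp (p \<bullet> phi v) * (exp ?t - 1 - ?t)) *\<^sub>R W v"
        by (simp add: yq inner_add_left exp_add algebra_simps)
      then have "norm (exp (y \<bullet> phi v) *\<^sub>R W v - exp (p \<bullet> phi v) *\<^sub>R W v
            - (?t * exp (p \<bullet> phi v)) *\<^sub>R W v) = exp (p \<bullet> phi v) * \<bar>exp ?t - 1 - ?t\<bar> * norm (W v)"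
        by (simp add: abs_mult)
      also have "\<bar>exp ?t - 1 - ?t\<bar> \<le> (norm q * norm (phi v))\<^sup>2 * exp (d * norm (phi v))"
      proof (rule order_trans[OF taylor mult_mono])
        show "?t\<^sup>2 \<le> (norm q * norm (phi v))\<^sup>2"
          using t by (simp add: abs_le_square_iff[symmetric] abs_mult)
        show "exp \<bar>?t\<bar> \<le> exp (d * norm (phi v))"
          using t nq mult_right_mono[of "norm q" d "norm (phi v)"] by (simp add: order_trans)
      qed auto
      finally have "norm (exp (y \<bullet> phi v) *\<^sub>R W v - exp (p \<bullet> phi v) *\<^sub>R W v
            - (?t * exp (p \<bullet> phi v)) *\<^sub>R W v)
          \<le> exp (p \<bullet> phi v) * ((norm q * norm (phi v))\<^sup>2 * exp (d * norm (phi v))) * norm (W v)"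
        by (simp add: mult_left_mono mult_right_mono)
      also have "exp (p \<bullet> phi v) * exp (d * norm (phi v)) = exp ((p + d *\<^sub>R (1, 0, 1)) \<bullet> phi v)"
        by (simp add: exp_add inner_add_left norm_phi) (simp add: phi_def algebra_simps)
      then have "exp (p \<bullet> phi v) * ((norm q * norm (phi v))\<^sup>2 * exp (d * norm (phi v))) * norm (W v)
          = (norm q)\<^sup>2 * ?R v"
        by (simp add: power_mult_distrib mult_ac)
      finally show "norm (exp (y \<bullet> phi v) *\<^sub>R W v - exp (p \<bullet> phi v) *\<^sub>R W v
            - (?t * exp (p \<bullet> phi v)) *\<^sub>R W v) \<le> (norm q)\<^sup>2 * ?R v" .
    qed (use int_R int_0 int_1 y0 p in auto)
    also have "\<dots> = (norm q)\<^sup>2 * K" by (simp add: K_def)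
    finally show ?thesis by (simp add: q_def)
  qed
  show ?thesis
  proof (rule has_derivativeI_sandwich[OF \<open>d > 0\<close> lin])
    show "norm ((\<integral>v. exp (y \<bullet> phi v) *\<^sub>R W v \<partial>lborel) - (\<integral>v. exp (p \<bullet> phi v) *\<^sub>R W v \<partial>lborel)
      - (\<integral>v. (((y - p) \<bullet> phi v) * exp (p \<bullet> phi v)) *\<^sub>R W v \<partial>lborel)) / norm (y - p)
      \<le> norm (y - p) * K" if "y \<noteq> p" "dist y p < d" for y
      using remainder[OF that(2)] that(1) by (simp add: divide_le_eq power2_eq_square mult_ac)
    show "((\<lambda>y. norm (y - p) * K) \<longlongrightarrow> 0) (at p)"
      by (rule tendsto_eq_intros refl | simp)+
  qed
qed

section \<open>Rotation invariance and centred moments\<close>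

lemma borel_measurable_orthogonal_transformation:
  fixes f :: "'a::euclidean_space \<Rightarrow> 'a"
  assumes "orthogonal_transformation f"
  shows "f \<in> borel_measurable borel"
  using assms
  by (intro borel_measurable_continuous_onI linear_continuous_on)
     (simp add: linear_conv_bounded_linear[symmetric] orthogonal_transformation_linear)

text \<open>
  Agreement on boxes identifies a measure as Lebesgue measure, and the preimage of a box under \<open>f\<close>
  is its image under the inverse isometry, which has the same volume.
\<close>

lemma lborel_distr_orthogonal:
  fixes f :: "real^3 \<Rightarrow> real^3"
  assumes "orthogonal_transformation f"
  shows "distr lborel borel f = lborel"
proof -
  have meas [measurable]: "f \<in> borel_measurable borel"
    using assms by (rule borel_measurable_orthogonal_transformation)
  obtain g where g: "orthogonal_transformation g" "\<And>x. g (f x) = x" "\<And>x. f (g x) = x"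
    using assms by (metis orthogonal_transformation_inv orthogonal_transformation_bij bij_inv_eq_iff)
  have "lborel = distr lborel borel f"
  proof (rule lborel_eqI)
    fix l u :: "real^3"
    assume le: "\<And>b. b \<in> Basis \<Longrightarrow> l \<bullet> b \<le> u \<bullet> b"
    have vim: "f -` box l u = g ` box l u"
    proof (intro equalityI subsetI)
      fix x assume "x \<in> f -` box l u"
      then show "x \<in> g ` box l u" using g(2)[of x] by (intro image_eqI[of _ _ "f x"]) auto
    next
      fix x assume "x \<in> g ` box l u"
      then show "x \<in> f -` box l u" using g(3) by (auto simp del: mem_box)
    qed
    have "emeasure (distr lborel borel f) (box l u) = emeasure lborel (f -` box l u)"
      by (subst emeasure_distr) auto
    also have "\<dots> = emeasure lebesgue (g ` box l u)"
      unfolding vim[symmetric] using measurable_sets_borel[OF meas, of "box l u"] by simp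
    also have "\<dots> = ennreal (measure lebesgue (g ` box l u))"
      using g(1) by (intro emeasure_eq_measure2 measurable_orthogonal_image) auto
    also have "\<dots> = (\<Prod>b\<in>Basis. (u - l) \<bullet> b)"
      using measure_orthogonal_image[OF g(1), of "box l u"] le
      by (simp add: measure_lborel_box_eq)
    finally show "emeasure (distr lborel borel f) (box l u) = (\<Prod>b\<in>Basis. (u - l) \<bullet> b)" .
  qed simp
  then show ?thesis by simp
qed

lemma integral_lborel_orthogonal:
  fixes f :: "real^3 \<Rightarrow> real^3" and h :: "real^3 \<Rightarrow> real"
  assumes f: "orthogonal_transformation f" and [measurable]: "h \<in> borel_measurable borel"
  shows "(\<integral>w. h (f w) \<partial>lborel) = (\<integral>w. h w \<partial>lborel)"
proof -
  note [measurable] = borel_measurable_orthogonal_transformation[OF f]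
  have "(\<integral>w. h w \<partial>lborel) = (\<integral>w. h w \<partial>distr lborel borel f)"
    by (simp add: lborel_distr_orthogonal f)
  also have "\<dots> = (\<integral>w. h (f w) \<partial>lborel)"
    by (rule integral_distr) auto
  finally show ?thesis by simp
qed

lemma integral_odd_eq_0:
  fixes h :: "real^3 \<Rightarrow> real"
  assumes "h \<in> borel_measurable borel" and "\<And>w. h (- w) = - h w"
  shows "(\<integral>w. h w \<partial>lborel) = 0"
  using integral_lborel_orthogonal[of uminus h] assms
  by (simp add: orthogonal_transformation_def linear_uminus linear_id module_hom_uminus)

text \<open>
  Isotropy. A rotation that takes \<open>a\<close> to \<open>b\<close> shows that the second moment in the direction
  \<open>a\<close> depends on \<open>norm a\<close> only. Averaging over the three axes identifies it as a third of the
  full second moment, and polarization gives the mixed moments.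
\<close>

lemma second_moment_radial:
  fixes G :: "real^3 \<Rightarrow> real"
  assumes [measurable]: "G \<in> borel_measurable borel"
    and radial: "\<And>w w'. norm w = norm w' \<Longrightarrow> G w = G w'"
    and int: "integrable lborel (\<lambda>w. G w * (norm w)\<^sup>2)"
  shows "has_bochner_integral lborel (\<lambda>w. G w * ((w \<bullet> a) * (w \<bullet> b)))
           ((\<integral>w. G w * (norm w)\<^sup>2 \<partial>lborel) / 3 * (a \<bullet> b))"
proof -
  let ?q = "\<lambda>a. \<integral>w. G w * (w \<bullet> a)\<^sup>2 \<partial>lborel"
  have int_q: "integrable lborel (\<lambda>w. G w * (w \<bullet> a)\<^sup>2)" for a
  proof (rule Bochner_Integration.integrable_bound)
    show "integrable lborel (\<lambda>w. (norm a)\<^sup>2 * (G w * (norm w)\<^sup>2))" by (simp add: int)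
    have "(w \<bullet> a)\<^sup>2 \<le> (norm w)\<^sup>2 * (norm a)\<^sup>2" for w
      using Cauchy_Schwarz_ineq[of w a] by (simp add: power2_norm_eq_inner)
    then have "\<bar>G w\<bar> * (w \<bullet> a)\<^sup>2 \<le> \<bar>G w\<bar> * ((norm w)\<^sup>2 * (norm a)\<^sup>2)" for w
      by (simp add: mult_left_mono)
    then show "AE w in lborel. norm (G w * (w \<bullet> a)\<^sup>2) \<le> norm ((norm a)\<^sup>2 * (G w * (norm w)\<^sup>2))"
      by (simp add: abs_mult mult_ac)
  qed measurable
  have q_norm: "?q a = ?q b" if eq: "norm a = norm b" for a b
  proof -
    obtain f where f: "orthogonal_transformation f" "f a = b"
      using orthogonal_transformation_exists[OF eq] .
    have "?q b = (\<integral>w. G (f w) * (f w \<bullet> b)\<^sup>2 \<partial>lborel)"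
      by (rule integral_lborel_orthogonal[symmetric, OF f(1)]) measurable
    also have "\<dots> = ?q a"
    proof -
      have "f w \<bullet> b = w \<bullet> a" for w
        using f by (auto simp: orthogonal_transformation_def)
      moreover have "G (f w) = G w" for w
        by (rule radial) (simp add: f(1) orthogonal_transformation_norm)
      ultimately show ?thesis by simp
    qed
    finally show ?thesis by simp
  qed
  define m where "m = (\<integral>w. G w * (norm w)\<^sup>2 \<partial>lborel) / 3"
  have q: "?q a = m * (a \<bullet> a)" for a
  proof -
    have "?q a = ?q (norm a *\<^sub>R axis i 1)" for i
      by (rule q_norm) simp
    then have "(\<Sum>i\<in>(UNIV::3 set). ?q a) = (\<Sum>i\<in>UNIV. ?q (norm a *\<^sub>R axis i 1))"
      by (intro sum.cong) auto
    also have "\<dots> = (\<integral>w. (\<Sum>i\<in>UNIV. G w * (w \<bullet> (norm a *\<^sub>R axis i 1))\<^sup>2) \<partial>lborel)"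
      by (rule Bochner_Integration.integral_sum[symmetric]) (rule int_q)
    also have "\<dots> = (\<integral>w. (norm a)\<^sup>2 * (G w * (norm w)\<^sup>2) \<partial>lborel)"
    proof (rule Bochner_Integration.integral_cong)
      fix w :: "real^3"
      have "(\<Sum>i\<in>UNIV. G w * (w \<bullet> (norm a *\<^sub>R axis i 1))\<^sup>2)
          = (norm a)\<^sup>2 * (G w * (\<Sum>i\<in>UNIV. (w $ i)\<^sup>2))"
        by (simp add: inner_axis power_mult_distrib sum_distrib_left mult_ac)
      also have "(\<Sum>i\<in>UNIV. (w $ i)\<^sup>2) = (norm w)\<^sup>2"
        unfolding power2_norm_eq_inner inner_vec_def by (simp add: power2_eq_square)
      finally show "(\<Sum>i\<in>UNIV. G w * (w \<bullet> (norm a *\<^sub>R axis i 1))\<^sup>2) = (norm a)\<^sup>2 * (G w * (norm w)\<^sup>2)" .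
    qed simp
    finally show ?thesis by (simp add: power2_norm_eq_inner m_def mult.commute)
  qed
  have hbq: "has_bochner_integral lborel (\<lambda>w. G w * (w \<bullet> a)\<^sup>2) (m * (a \<bullet> a))" for a
    using int_q q by (simp add: has_bochner_integral_iff)
  have "has_bochner_integral lborel
      (\<lambda>w. (G w * (w \<bullet> (a + b))\<^sup>2 - G w * (w \<bullet> (a - b))\<^sup>2) * (1 / 4))
      ((m * ((a + b) \<bullet> (a + b)) - m * ((a - b) \<bullet> (a - b))) * (1 / 4))"
    by (intro has_bochner_integral_mult_left has_bochner_integral_diff hbq)
  also have "(\<lambda>w. (G w * (w \<bullet> (a + b))\<^sup>2 - G w * (w \<bullet> (a - b))\<^sup>2) * (1 / 4))
      = (\<lambda>w. G w * ((w \<bullet> a) * (w \<bullet> b)))"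
    by (rule ext) (simp add: inner_add_right inner_diff_right power2_eq_square algebra_simps)
  also have "(m * ((a + b) \<bullet> (a + b)) - m * ((a - b) \<bullet> (a - b))) * (1 / 4) = m * (a \<bullet> b)"
    by (simp add: inner_add_left inner_diff_left inner_add_right inner_diff_right inner_commute[of b a]
      algebra_simps)
  finally show ?thesis by (simp only: m_def)
qed

lemma integral_translate:
  fixes h :: "real^3 \<Rightarrow> 'b::euclidean_space"
  assumes [measurable]: "h \<in> borel_measurable borel"
  shows "(\<integral>w. h (u + w) \<partial>lborel) = (\<integral>v. h v \<partial>lborel)"
  by (subst (2) lborel_distr_plus[of u, symmetric]) (simp add: integral_distr)

section \<open>Maxwellians and the Euler flux\<close>

text \<open>
  Expanding the square in the exponent of a Maxwellian puts it into the form
  \<open>exp (p \<bullet> phi v)\<close>. This \<open>p\<close> is the natural parameter in the sense of exponential families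
  (in gas dynamics, the vector of entropy variables).
\<close>

definition natural_param :: "(real ^ 3 \<Rightarrow> real) \<Rightarrow> macro" where
  "natural_param g =
     (let \<rho> = density g; u = bulk_velocity g; T = temperature g in
      (ln (\<rho> / (2 * pi * T) powr (3 / 2)) - (norm u)\<^sup>2 / (2 * T), (1 / T) *\<^sub>R u, - 1 / T))"

lemma maxwellian_eq_exp_family:
  assumes "density g > 0" and "temperature g > 0"
  shows "maxwellian g v = exp (natural_param g \<bullet> phi v)"
proof -
  define c where "c = density g / (2 * pi * temperature g) powr (3 / 2)"
  have "c > 0" using assms by (simp add: c_def)
  have "natural_param g \<bullet> phi v = ln c + - (norm (bulk_velocity g - v))\<^sup>2 / (2 * temperature g)"
    using assms(2)
    by (simp add: natural_param_def Let_def inner_phi c_def[symmetric])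
       (simp add: field_simps power2_norm_eq_inner inner_diff_left inner_diff_right inner_commute)
  then show ?thesis
    using \<open>c > 0\<close> by (simp only: exp_add) (simp add: maxwellian_def c_def[symmetric])
qed

text \<open>
  The flux weight, bounded in the form \<open>C * norm (phi v) ^ n\<close> of the integrability lemmas.
\<close>

lemma norm_velocity_component_phi: "norm (v $ j *\<^sub>R phi v) \<le> 1 * norm (phi v) ^ 2"
proof -
  have "\<bar>v $ j\<bar> \<le> norm (phi v)"
    using component_le_norm_cart[of v j] norm_le_norm_phi[of v] by linarith
  then show ?thesis
    by (simp add: power2_eq_square mult_right_mono)
qed

text \<open>
  Write \<open>v = u + w\<close>. A Maxwellian is a radial function of \<open>w\<close>, so its odd moments in \<open>w\<close> vanish
  and its second moments are isotropic, with total \<open>3\<rho>T\<close> by the definition of the temperature.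
  These facts determine the flux.
\<close>

lemma maxwellian_flux:
  assumes adm: "g \<in> admissible" and eq: "g = maxwellian g"
  shows "(\<integral>v. g v *\<^sub>R (v $ j *\<^sub>R phi v) \<partial>lborel) = euler_flux j (moments g)"
proof -
  define \<rho> u T where "\<rho> = density g" and "u = bulk_velocity g" and "T = temperature g"
  have "\<rho> > 0" "T > 0" and hm: "integrable lborel (\<lambda>v. g v *\<^sub>R phi v)"
    using adm by (auto simp: admissible_def has_moments_def \<rho>_def T_def)
  define G where "G w = g (u + w)" for w
  define p0 :: macro where "p0 = (ln (\<rho> / (2 * pi * T) powr (3 / 2)), 0, - 1 / T)"
  have G: "G w = exp (p0 \<bullet> phi w)" for w
  proof -
    have "0 < \<rho> / (2 * pi * T) powr (3 / 2)" using \<open>\<rho> > 0\<close> \<open>T > 0\<close> by simp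
    then have "exp (p0 \<bullet> phi w) = \<rho> / (2 * pi * T) powr (3 / 2) * exp (- (norm w)\<^sup>2 / (2 * T))"
      by (simp add: p0_def inner_phi exp_add[symmetric] exp_diff exp_minus field_simps)
    also have "\<dots> = G w"
      unfolding G_def by (subst eq) (simp add: maxwellian_def \<rho>_def u_def T_def)
    finally show ?thesis by simp
  qed
  have p0: "snd (snd p0) < 0" using \<open>T > 0\<close> by (simp add: p0_def)
  have radial: "G w = G w'" if "norm w = norm w'" for w w'
    using that by (simp add: G inner_phi p0_def)
  have G_meas [measurable]: "G \<in> borel_measurable borel"
    unfolding G by measurable
  define P where "P = natural_param g"
  have g_eq: "g v = exp (P \<bullet> phi v)" for v
    unfolding P_def using maxwellian_eq_exp_family[of g v] eq \<open>\<rho> > 0\<close> \<open>T > 0\<close> by (metis \<rho>_def T_def)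
  have np: "snd (snd P) < 0"
    using \<open>T > 0\<close> by (simp add: P_def natural_param_def Let_def T_def)
  have g_meas [measurable]: "g \<in> borel_measurable borel"
    unfolding g_eq[abs_def] by measurable
  have int_g: "integrable lborel (\<lambda>v. g v *\<^sub>R W v)"
    if "W \<in> borel_measurable borel" "\<And>v. norm (W v) \<le> C * norm (phi v) ^ n"
    for C n and W :: "real^3 \<Rightarrow> 'b::euclidean_space"
    unfolding g_eq by (rule integrable_exp_family_weight[OF np that])
  have int_G: "integrable lborel (\<lambda>w. G w * W w)"
    if "W \<in> borel_measurable borel" "\<And>w. \<bar>W w\<bar> \<le> C * norm (phi w) ^ n" for W C n
    unfolding G using integrable_exp_family_weight[OF p0 that(1), of C n] that(2) by simp
  have shift: "(\<integral>v. g v * h v \<partial>lborel) = (\<integral>w. G w * h (u + w) \<partial>lborel)"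
    if [measurable]: "h \<in> borel_measurable borel" for h
    unfolding G_def by (rule integral_translate[symmetric]) measurable
  define E where "E = (\<integral>v. g v * ((norm v)\<^sup>2 / 2) \<partial>lborel)"

  have moments_eq: "moments g = (\<rho>, \<rho> *\<^sub>R u, E)"
  proof -
    have "snd (snd (moments g)) = (\<integral>v. snd (snd (g v *\<^sub>R phi v)) \<partial>lborel)"
      unfolding moments_def
      by (rule integral_bounded_linear[symmetric, OF _ hm])
         (intro bounded_linear_snd_comp bounded_linear_snd)
    moreover have "\<rho> *\<^sub>R u = fst (snd (moments g))"
      using \<open>\<rho> > 0\<close> by (simp add: u_def bulk_velocity_def \<rho>_def)
    ultimately show ?thesis
      by (simp add: prod_eq_iff \<rho>_def density_def phi_def E_def)
  qed
  \<comment> \<open>\<open>B0\<close> to \<open>B3\<close> are the moments of the centred distribution by order (the third one contracted),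
    \<open>Bn\<close> is the trace of the second\<close>
  have B0: "has_bochner_integral lborel G \<rho>"
  proof -
    have "\<rho> = (\<integral>v. fst (g v *\<^sub>R phi v) \<partial>lborel)"
      unfolding \<rho>_def density_def moments_def
      by (rule integral_bounded_linear[symmetric, OF bounded_linear_fst hm])
    also have "\<dots> = (\<integral>w. G w \<partial>lborel)"
      using shift[of "\<lambda>_. 1"] by (simp add: phi_def)
    finally show ?thesis
      using int_G[of "\<lambda>_. 1" 1 0] by (simp add: has_bochner_integral_iff)
  qed
  have sq_le: "(norm w)\<^sup>2 \<le> 2 * norm (phi w) ^ 1" for w
    by (simp add: norm_phi)
  have Bn: "has_bochner_integral lborel (\<lambda>w. G w * (norm w)\<^sup>2) (3 * \<rho> * T)"
  proof -
    have "3 * \<rho> * T = (\<integral>v. g v * (norm (v - u))\<^sup>2 \<partial>lborel)"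
      using \<open>\<rho> > 0\<close> by (simp add: T_def temperature_def \<rho>_def u_def mult.commute)
    also have "\<dots> = (\<integral>w. G w * (norm w)\<^sup>2 \<partial>lborel)"
      by (subst shift) auto
    finally show ?thesis
      using int_G[of "\<lambda>w. (norm w)\<^sup>2" 2 1] sq_le by (simp add: has_bochner_integral_iff)
  qed
  have lin_le: "\<bar>w \<bullet> a\<bar> \<le> norm a * norm (phi w)" for w a :: "real^3"
    using Cauchy_Schwarz_ineq2[of w a] mult_left_mono[OF norm_le_norm_phi[of w], of "norm a"]
    by (simp add: mult.commute)
  have G_even: "G (- w) = G w" for w by (rule radial) simp
  have B1: "has_bochner_integral lborel (\<lambda>w. G w * (w \<bullet> a)) 0" for a
    using int_G[of "\<lambda>w. w \<bullet> a" "norm a" 1] lin_le integral_odd_eq_0[of "\<lambda>w. G w * (w \<bullet> a)"] G_even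
    by (simp add: has_bochner_integral_iff)
  have B2: "has_bochner_integral lborel (\<lambda>w. G w * ((w \<bullet> a) * (w \<bullet> b))) (\<rho> * T * (a \<bullet> b))" for a b
    using second_moment_radial[OF G_meas radial, of a b] Bn by (auto simp: has_bochner_integral_iff)
  have B3: "has_bochner_integral lborel (\<lambda>w. G w * ((w \<bullet> a) * (norm w)\<^sup>2)) 0" for a
  proof -
    have "\<bar>(w \<bullet> a) * (norm w)\<^sup>2\<bar> \<le> (norm a * 2) * norm (phi w) ^ 2" for w
      using mult_mono[OF lin_le[of w a] sq_le[of w]] by (simp add: abs_mult power2_eq_square mult_ac)
    then show ?thesis
      using int_G[of "\<lambda>w. (w \<bullet> a) * (norm w)\<^sup>2" "norm a * 2" 2]
        integral_odd_eq_0[of "\<lambda>w. G w * ((w \<bullet> a) * (norm w)\<^sup>2)"] G_even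
      by (simp add: has_bochner_integral_iff)
  qed

  have E: "E = \<rho> * (norm u)\<^sup>2 / 2 + 3 * \<rho> * T / 2"
  proof -
    have "has_bochner_integral lborel
        (\<lambda>w. (G w * (norm u)\<^sup>2 + G w * (w \<bullet> u) * 2 + G w * (norm w)\<^sup>2) * (1 / 2))
        ((\<rho> * (norm u)\<^sup>2 + 0 * 2 + 3 * \<rho> * T) * (1 / 2))"
      by (intro has_bochner_integral_add has_bochner_integral_mult_left B0 B1 Bn)
    also have "(\<lambda>w. (G w * (norm u)\<^sup>2 + G w * (w \<bullet> u) * 2 + G w * (norm w)\<^sup>2) * (1 / 2))
        = (\<lambda>w. G w * ((norm (u + w))\<^sup>2 / 2))"
      by (rule ext)
         (simp add: power2_norm_eq_inner inner_add_left inner_add_right inner_commute algebra_simps)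
    finally show ?thesis
      unfolding E_def by (subst shift) (simp_all add: has_bochner_integral_iff field_simps)
  qed
  have pressure: "pressure (\<rho>, \<rho> *\<^sub>R u, E) = \<rho> * T"
    using \<open>\<rho> > 0\<close> by (simp add: E field_simps)
  have mom2: "(\<integral>v. g v * (v $ j * v $ i) \<partial>lborel) = \<rho> * u $ j * u $ i + \<rho> * T * axis j 1 $ i" for i
  proof -
    let ?a = "axis j 1 :: real^3" and ?b = "axis i 1 :: real^3"
    have "has_bochner_integral lborel
        (\<lambda>w. G w * (u $ j * u $ i) + G w * (w \<bullet> ?a) * u $ i + G w * (w \<bullet> ?b) * u $ j
             + G w * ((w \<bullet> ?a) * (w \<bullet> ?b)))
        (\<rho> * (u $ j * u $ i) + 0 * u $ i + 0 * u $ j + \<rho> * T * (?a \<bullet> ?b))"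
      by (intro has_bochner_integral_add has_bochner_integral_mult_left B0 B1 B2)
    also have "(\<lambda>w. G w * (u $ j * u $ i) + G w * (w \<bullet> ?a) * u $ i + G w * (w \<bullet> ?b) * u $ j
             + G w * ((w \<bullet> ?a) * (w \<bullet> ?b))) = (\<lambda>w. G w * ((u + w) $ j * (u + w) $ i))"
      by (rule ext) (simp add: inner_axis algebra_simps)
    finally show ?thesis
      by (subst shift) (simp_all add: has_bochner_integral_iff inner_axis)
  qed
  have mom3: "(\<integral>v. g v * (v $ j * ((norm v)\<^sup>2 / 2)) \<partial>lborel) = E * u $ j + \<rho> * T * u $ j"
  proof -
    let ?a = "axis j 1 :: real^3"
    have "has_bochner_integral lborel
        (\<lambda>w. (G w * (norm u)\<^sup>2 + G w * (w \<bullet> u) * 2 + G w * (norm w)\<^sup>2) * (u $ j / 2)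
             + G w * (w \<bullet> ?a) * ((norm u)\<^sup>2 / 2) + G w * ((w \<bullet> ?a) * (w \<bullet> u))
             + G w * ((w \<bullet> ?a) * (norm w)\<^sup>2) * (1 / 2))
        ((\<rho> * (norm u)\<^sup>2 + 0 * 2 + 3 * \<rho> * T) * (u $ j / 2)
             + 0 * ((norm u)\<^sup>2 / 2) + \<rho> * T * (?a \<bullet> u) + 0 * (1 / 2))"
      by (intro has_bochner_integral_add has_bochner_integral_mult_left B0 B1 B2 Bn B3)
    also have "(\<lambda>w. (G w * (norm u)\<^sup>2 + G w * (w \<bullet> u) * 2 + G w * (norm w)\<^sup>2) * (u $ j / 2)
             + G w * (w \<bullet> ?a) * ((norm u)\<^sup>2 / 2) + G w * ((w \<bullet> ?a) * (w \<bullet> u))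
             + G w * ((w \<bullet> ?a) * (norm w)\<^sup>2) * (1 / 2))
        = (\<lambda>w. G w * ((u + w) $ j * ((norm (u + w))\<^sup>2 / 2)))"
    proof (rule ext)
      fix w
      have "(norm (u + w))\<^sup>2 = (norm u)\<^sup>2 + 2 * (w \<bullet> u) + (norm w)\<^sup>2"
        by (simp add: power2_norm_eq_inner inner_add_left inner_add_right inner_commute)
      then show "(G w * (norm u)\<^sup>2 + G w * (w \<bullet> u) * 2 + G w * (norm w)\<^sup>2) * (u $ j / 2)
             + G w * (w \<bullet> ?a) * ((norm u)\<^sup>2 / 2) + G w * ((w \<bullet> ?a) * (w \<bullet> u))
             + G w * ((w \<bullet> ?a) * (norm w)\<^sup>2) * (1 / 2)
          = G w * ((u + w) $ j * ((norm (u + w))\<^sup>2 / 2))"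
        by (simp add: inner_axis field_simps)
    qed
    finally show ?thesis
      by (subst shift) (simp_all add: has_bochner_integral_iff inner_axis' E field_simps)
  qed

  let ?J = "\<integral>v. g v *\<^sub>R (v $ j *\<^sub>R phi v) \<partial>lborel"
  have int_J: "integrable lborel (\<lambda>v. g v *\<^sub>R (v $ j *\<^sub>R phi v))"
    by (rule int_g[OF _ norm_velocity_component_phi]) measurable
  have proj: "L ?J = (\<integral>v. L (g v *\<^sub>R (v $ j *\<^sub>R phi v)) \<partial>lborel)" if "bounded_linear L"
    for L :: "macro \<Rightarrow> real"
    by (rule integral_bounded_linear[symmetric, OF that int_J])
  have "fst ?J = (\<integral>v. fst (snd (g v *\<^sub>R phi v)) $ j \<partial>lborel)"
    by (subst proj[OF bounded_linear_fst]) (simp add: phi_def)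
  also have "\<dots> = fst (snd (moments g)) $ j"
    unfolding moments_def
    by (rule integral_bounded_linear[OF _ hm])
       (intro bounded_linear_intros bounded_linear_compose[OF bounded_linear_vec_nth]
         bounded_linear_fst_comp bounded_linear_snd)
  finally have J1: "fst ?J = \<rho> * u $ j" by (simp add: moments_eq)
  have J2: "fst (snd ?J) $ i = \<rho> * u $ j * u $ i + \<rho> * T * axis j 1 $ i" for i
    using proj[of "\<lambda>z. fst (snd z) $ i"] mom2[of i]
    by (simp add: phi_def mult.assoc bounded_linear_fst_comp bounded_linear_snd
        bounded_linear_compose[OF bounded_linear_vec_nth])
  have J3: "snd (snd ?J) = E * u $ j + \<rho> * T * u $ j"
    using proj[of "\<lambda>z. snd (snd z)"] mom3
    by (simp add: phi_def mult.assoc bounded_linear_snd_comp bounded_linear_snd)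
  have "?J = (\<rho> * u $ j, (\<rho> * u $ j) *\<^sub>R u + (\<rho> * T) *\<^sub>R axis j 1, E * u $ j + \<rho> * T * u $ j)"
    using J1 J2 J3 by (simp add: prod_eq_iff Finite_Cartesian_Product.vec_eq_iff)
  also have "\<dots> = euler_flux j (moments g)"
    unfolding moments_eq euler_flux.simps pressure Let_def using \<open>\<rho> > 0\<close> by simp
  finally show ?thesis .
qed

section \<open>Transport of a field of Maxwellians\<close>

text \<open>
  The vectors \<open>phi v\<close> at \<open>v = 0\<close> and at the six points \<open>v = \<plusminus>e\<^sub>i\<close> span the whole space, so
  \<open>P\<close> is a fixed linear combination of the functions \<open>P y \<bullet> phi v\<close> at these velocities.
\<close>

lemma differentiable_of_inner_phi:
  fixes P :: "'a::real_normed_vector \<Rightarrow> macro"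
  assumes "\<And>v. (\<lambda>y. P y \<bullet> phi v) differentiable (at x)"
  shows "P differentiable (at x)"
proof -
  define S where "S v y = P y \<bullet> phi v" for v y
  obtain D where D: "\<And>v. (S v has_derivative D v) (at x)"
    using assms unfolding differentiable_def S_def by metis
  define e :: "3 \<Rightarrow> real^3" where "e i = axis i 1" for i
  have P: "P y = (S 0 y, (\<Sum>i\<in>UNIV. ((1 / 2) * (S (e i) y - S (- e i) y)) *\<^sub>R e i),
      S (e 1) y + S (- e 1) y - 2 * S 0 y)" for y
  proof -
    have "fst (snd (P y)) = (\<Sum>i\<in>UNIV. (fst (snd (P y)) $ i) *\<^sub>R e i)"
      unfolding e_def
      by (simp add: Finite_Cartesian_Product.vec_eq_iff axis_def if_distrib cong: if_cong)
    then show ?thesis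
      by (simp add: prod_eq_iff S_def inner_phi e_def inner_axis)
  qed
  have "((\<lambda>y. (S 0 y, (\<Sum>i\<in>UNIV. ((1 / 2) * (S (e i) y - S (- e i) y)) *\<^sub>R e i),
      S (e 1) y + S (- e 1) y - 2 * S 0 y)) has_derivative
    (\<lambda>h. (D 0 h, (\<Sum>i\<in>UNIV. ((1 / 2) * (D (e i) h - D (- e i) h)) *\<^sub>R e i),
      D (e 1) h + D (- e 1) h - 2 * D 0 h))) (at x)"
    by (intro has_derivative_Pair has_derivative_sum has_derivative_scaleR_left
          has_derivative_mult_right has_derivative_add has_derivative_diff D)
  then show ?thesis
    unfolding P[symmetric] differentiable_def by blast
qed

text \<open>
  Differentiability in \<open>x\<close> at each fixed velocity carries over to the moments because the
  logarithm of the Maxwellian is \<open>P \<bullet> phi v\<close>: seven velocities already control the natural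
  parameter \<open>P\<close>, and the flux is a differentiable function of it.
  The derivatives of the Maxwellian and of its flux come from the same derivative \<open>D\<close> of \<open>P\<close>.
\<close>

lemma maxwellian_field_derivatives:
  fixes \<Omega> :: "(real ^ 'd::finite) set"
  assumes "open \<Omega>" "x \<in> \<Omega>"
    and adm: "\<And>y. y \<in> \<Omega> \<Longrightarrow> F y \<in> admissible"
    and maxw: "\<And>y. y \<in> \<Omega> \<Longrightarrow> F y = maxwellian (F y)"
    and diff: "\<And>v. (\<lambda>y. F y v) differentiable (at x)"
  obtains D where "\<And>v. ((\<lambda>y. F y v) has_derivative (\<lambda>h. (D h \<bullet> phi v) * F x v)) (at x)"
    and "\<And>j. ((\<lambda>y. euler_flux j (moments (F y))) has_derivative
          (\<lambda>h. \<integral>v. ((D h \<bullet> phi v) * F x v) *\<^sub>R (v $ j *\<^sub>R phi v) \<partial>lborel)) (at x)"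
    and "\<And>h j. integrable lborel (\<lambda>v. ((D h \<bullet> phi v) * F x v) *\<^sub>R (v $ j *\<^sub>R phi v))"
proof -
  define P where "P y = natural_param (F y)" for y
  have F: "F y v = exp (P y \<bullet> phi v)" if "y \<in> \<Omega>" for y v
    using maxwellian_eq_exp_family[of "F y" v] adm[OF that] maxw[OF that]
    by (simp add: admissible_def P_def)
  have neg: "snd (snd (P y)) < 0" if "y \<in> \<Omega>" for y
    using adm[OF that] by (simp add: P_def natural_param_def Let_def admissible_def)
  have "P differentiable (at x)"
  proof (rule differentiable_of_inner_phi)
    fix v
    obtain D where "((\<lambda>y. F y v) has_derivative D) (at x)"
      using diff unfolding differentiable_def by blast
    moreover have "F x v > 0" by (simp add: F \<open>x \<in> \<Omega>\<close>)
    ultimately have "((\<lambda>y. ln (F y v)) has_derivative (\<lambda>h. D h * inverse (F x v))) (at x)"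
      by (rule has_derivative_ln[rotated])
    then have "((\<lambda>y. P y \<bullet> phi v) has_derivative (\<lambda>h. D h * inverse (F x v))) (at x)"
      by (rule has_derivative_transform_within_open[OF _ \<open>open \<Omega>\<close> \<open>x \<in> \<Omega>\<close>]) (simp add: F)
    then show "(\<lambda>y. P y \<bullet> phi v) differentiable (at x)"
      unfolding differentiable_def by blast
  qed
  then obtain D where D: "(P has_derivative D) (at x)"
    unfolding differentiable_def by blast
  show thesis
  proof
    fix v
    have "((\<lambda>y. exp (P y \<bullet> phi v)) has_derivative (\<lambda>h. (D h \<bullet> phi v) * F x v)) (at x)"
      using D by (auto intro!: derivative_eq_intros simp: F \<open>x \<in> \<Omega>\<close> mult.commute)
    then show "((\<lambda>y. F y v) has_derivative (\<lambda>h. (D h \<bullet> phi v) * F x v)) (at x)"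
      by (rule has_derivative_transform_within_open[OF _ \<open>open \<Omega>\<close> \<open>x \<in> \<Omega>\<close>]) (simp add: F)
  next
    fix j
    have "((\<lambda>y. \<integral>v. exp (P y \<bullet> phi v) *\<^sub>R (v $ j *\<^sub>R phi v) \<partial>lborel) has_derivative
        (\<lambda>h. \<integral>v. ((D h \<bullet> phi v) * exp (P x \<bullet> phi v)) *\<^sub>R (v $ j *\<^sub>R phi v) \<partial>lborel)) (at x)"
      by (rule has_derivative_compose[OF D has_derivative_exp_family_integral[OF neg
            _ norm_velocity_component_phi]]) (use \<open>x \<in> \<Omega>\<close> in auto)
    then have "((\<lambda>y. \<integral>v. exp (P y \<bullet> phi v) *\<^sub>R (v $ j *\<^sub>R phi v) \<partial>lborel) has_derivative
        (\<lambda>h. \<integral>v. ((D h \<bullet> phi v) * F x v) *\<^sub>R (v $ j *\<^sub>R phi v) \<partial>lborel)) (at x)"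
      by (simp add: F \<open>x \<in> \<Omega>\<close>)
    then show "((\<lambda>y. euler_flux j (moments (F y))) has_derivative
          (\<lambda>h. \<integral>v. ((D h \<bullet> phi v) * F x v) *\<^sub>R (v $ j *\<^sub>R phi v) \<partial>lborel)) (at x)"
      by (rule has_derivative_transform_within_open[OF _ \<open>open \<Omega>\<close> \<open>x \<in> \<Omega>\<close>])
         (simp add: F maxwellian_flux[OF adm maxw, symmetric])
  next
    fix h j
    have "integrable lborel (\<lambda>v. ((D h \<bullet> phi v) * exp (P x \<bullet> phi v)) *\<^sub>R (v $ j *\<^sub>R phi v))"
      by (rule integrable_exp_family_derivative[OF neg[OF \<open>x \<in> \<Omega>\<close>] _ norm_velocity_component_phi])
         measurable
    then show "integrable lborel (\<lambda>v. ((D h \<bullet> phi v) * F x v) *\<^sub>R (v $ j *\<^sub>R phi v))"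
      by (simp add: F \<open>x \<in> \<Omega>\<close>)
  qed
qed

text \<open>
  The moment closure. It holds summand by summand: the moment of \<open>v\<^sub>k \<partial>\<^sub>k F\<close> is the \<open>k\<close>-th partial
  derivative of the flux in direction \<open>k\<close>, both being expressed through the same \<open>D\<close>.
\<close>

lemma moments_transport_maxwellian:
  fixes \<Omega> :: "(real ^ 'd::finite) set"
  assumes "open \<Omega>" "x \<in> \<Omega>"
    and "\<And>y. y \<in> \<Omega> \<Longrightarrow> F y \<in> admissible"
    and "\<And>y. y \<in> \<Omega> \<Longrightarrow> F y = maxwellian (F y)"
    and "\<And>v. (\<lambda>y. F y v) differentiable (at x)"
  shows "flux_differentiable \<iota> (\<lambda>y. moments (F y)) x"
    and "moments (transport \<iota> F x) = - div_flux \<iota> (\<lambda>y. moments (F y)) x"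
proof -
  obtain D where DF: "\<And>v. ((\<lambda>y. F y v) has_derivative (\<lambda>h. (D h \<bullet> phi v) * F x v)) (at x)"
    and DJ: "\<And>j. ((\<lambda>y. euler_flux j (moments (F y))) has_derivative
          (\<lambda>h. \<integral>v. ((D h \<bullet> phi v) * F x v) *\<^sub>R (v $ j *\<^sub>R phi v) \<partial>lborel)) (at x)"
    and int: "\<And>h j. integrable lborel (\<lambda>v. ((D h \<bullet> phi v) * F x v) *\<^sub>R (v $ j *\<^sub>R phi v))"
    using maxwellian_field_derivatives[OF assms] by blast
  show "flux_differentiable \<iota> (\<lambda>y. moments (F y)) x"
    unfolding flux_differentiable_def differentiable_def using DJ by blast
  have pF: "partial k (\<lambda>y. F y v) x = (D (axis k 1) \<bullet> phi v) * F x v" for k v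
    unfolding partial_def frechet_derivative_at[OF DF, symmetric] ..
  have pJ: "partial k (\<lambda>y. euler_flux j (moments (F y))) x
      = (\<integral>v. ((D (axis k 1) \<bullet> phi v) * F x v) *\<^sub>R (v $ j *\<^sub>R phi v) \<partial>lborel)" for k j
    unfolding partial_def frechet_derivative_at[OF DJ, symmetric] ..
  have "transport \<iota> F x v *\<^sub>R phi v
      = - (\<Sum>k\<in>UNIV. ((D (axis k 1) \<bullet> phi v) * F x v) *\<^sub>R (v $ \<iota> k *\<^sub>R phi v))" for v
    by (simp add: transport_def pF scaleR_sum_left mult_ac)
  then have "moments (transport \<iota> F x)
      = - (\<integral>v. (\<Sum>k\<in>UNIV. ((D (axis k 1) \<bullet> phi v) * F x v) *\<^sub>R (v $ \<iota> k *\<^sub>R phi v)) \<partial>lborel)"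
    unfolding moments_def by simp
  also have "(\<integral>v. (\<Sum>k\<in>UNIV. ((D (axis k 1) \<bullet> phi v) * F x v) *\<^sub>R (v $ \<iota> k *\<^sub>R phi v)) \<partial>lborel)
      = div_flux \<iota> (\<lambda>y. moments (F y)) x"
    unfolding div_flux_def pJ by (rule Bochner_Integration.integral_sum) (rule int)
  finally show "moments (transport \<iota> F x) = - div_flux \<iota> (\<lambda>y. moments (F y)) x" .
qed

section \<open>Linear algebra of type CK tableaux\<close>

lemma type_CK_first_row:
  assumes "A \<in> carrier_mat \<nu> \<nu>" and "type_CK \<nu> A"
  shows "\<nu> > 0" and "\<And>j. j < \<nu> \<Longrightarrow> A $$ (0, j) = 0"
proof -
  obtain a Ahat where a: "a \<in> carrier_mat (\<nu> - 1) 1" "Ahat \<in> carrier_mat (\<nu> - 1) (\<nu> - 1)"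
    and A: "A = four_block_mat (0\<^sub>m 1 1) (0\<^sub>m 1 (\<nu> - 1)) a Ahat"
    using assms(2) unfolding type_CK_def by blast
  have "\<nu> = 1 + (\<nu> - 1)"
    using assms(1) a unfolding A by (metis carrier_matD(1) index_mat_four_block(2) index_zero_mat(2))
  then show "\<nu> > 0" by simp
  show "A $$ (0, j) = 0" if "j < \<nu>" for j
    using that a \<open>\<nu> > 0\<close> unfolding A by (subst index_mat_four_block) auto
qed

text \<open>
  Once the first entry of \<open>q\<close> vanishes, the column \<open>a\<close> of the block form no longer contributes,
  and the remaining entries are annihilated by an invertible matrix.
\<close>

lemma type_CK_kernel:
  fixes q :: "nat \<Rightarrow> real"
  assumes A: "A \<in> carrier_mat \<nu> \<nu>" "type_CK \<nu> A" and q0: "q 0 = 0"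
    and Aq: "\<And>i. i < \<nu> \<Longrightarrow> (\<Sum>j<\<nu>. A $$ (i, j) * q j) = 0" and j: "j < \<nu>"
  shows "q j = 0"
proof (cases j)
  case (Suc k)
  obtain a Ahat where a: "a \<in> carrier_mat (\<nu> - 1) 1" and Ahat: "Ahat \<in> carrier_mat (\<nu> - 1) (\<nu> - 1)"
    and inv: "invertible_mat Ahat"
    and A_block: "A = four_block_mat (0\<^sub>m 1 1) (0\<^sub>m 1 (\<nu> - 1)) a Ahat"
    using A(2) unfolding type_CK_def by blast
  obtain B where B: "B * Ahat = 1\<^sub>m (dim_row B)" "Ahat * B = 1\<^sub>m (dim_row Ahat)"
    using inv unfolding invertible_mat_def inverts_mat_def by blast
  have Bc: "B \<in> carrier_mat (\<nu> - 1) (\<nu> - 1)"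
    using B Ahat by (metis carrier_matD carrier_matI index_mult_mat(2,3) index_one_mat(2,3))
  define x where "x = vec (\<nu> - 1) (\<lambda>k. q (Suc k))"
  have xc: "x \<in> carrier_vec (\<nu> - 1)" by (simp add: x_def)
  have "Ahat *\<^sub>v x = 0\<^sub>v (\<nu> - 1)"
  proof (rule eq_vecI)
    fix i assume i: "i < dim_vec (0\<^sub>v (\<nu> - 1) :: real Matrix.vec)"
    then obtain m where m: "\<nu> = Suc m" by (cases \<nu>) auto
    have "(\<Sum>j<\<nu>. A $$ (Suc i, j) * q j)
        = A $$ (Suc i, 0) * q 0 + (\<Sum>j<\<nu> - 1. A $$ (Suc i, Suc j) * q (Suc j))"
      unfolding m sum.lessThan_Suc_shift by simp
    also have "\<dots> = (\<Sum>j<\<nu> - 1. Ahat $$ (i, j) * q (Suc j))"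
      using i a Ahat q0 by (simp add: A_block)
    also have "\<dots> = (Ahat *\<^sub>v x) $ i"
      using i Ahat by (simp add: scalar_prod_def x_def lessThan_atLeast0)
    finally show "(Ahat *\<^sub>v x) $ i = 0\<^sub>v (\<nu> - 1) $ i"
      using Aq[of "Suc i"] i by simp
  qed (use Ahat in simp)
  moreover have "B *\<^sub>v (Ahat *\<^sub>v x) = x"
    using assoc_mult_mat_vec[OF Bc Ahat xc] B(1) Bc xc by simp
  ultimately have "x = 0\<^sub>v (\<nu> - 1)"
    using Bc by auto
  then have "x $ k = 0" using Suc j by simp
  then show ?thesis using Suc j by (simp add: x_def)
qed (simp add: q0)

section \<open>One step and its limit\<close>

lemma moments_imex_combination:
  fixes g q :: "nat \<Rightarrow> real^3 \<Rightarrow> real"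
  assumes "has_moments f" and g: "\<And>j. j < m \<Longrightarrow> has_moments (g j)"
    and q: "\<And>j. j < m \<Longrightarrow> has_moments (q j) \<and> moments (q j) = 0"
  shows "moments (\<lambda>v. f v + a * (\<Sum>j<m. b j * g j v) + c * (\<Sum>j<m. d j * q j v))
       = moments f + a *\<^sub>R (\<Sum>j<m. b j *\<^sub>R moments (g j))"
proof -
  have "moments (\<lambda>v. f v + a * (\<Sum>j<m. b j * g j v) + c * (\<Sum>j<m. d j * q j v))
      = (\<integral>v. f v *\<^sub>R phi v + a *\<^sub>R (\<Sum>j<m. b j *\<^sub>R (g j v *\<^sub>R phi v))
          + c *\<^sub>R (\<Sum>j<m. d j *\<^sub>R (q j v *\<^sub>R phi v)) \<partial>lborel)"
    unfolding moments_def by (simp add: scaleR_add_left scaleR_sum_left flip: scaleR_scaleR)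
  also have "\<dots> = moments f + a *\<^sub>R (\<Sum>j<m. b j *\<^sub>R moments (g j))
      + c *\<^sub>R (\<Sum>j<m. d j *\<^sub>R moments (q j))"
    using assms unfolding moments_def has_moments_def
    by (intro has_bochner_integral_integral_eq has_bochner_integral_add has_bochner_integral_scaleR_right
          has_bochner_integral_sum has_bochner_integral_integrable) auto
  finally show ?thesis using q by simp
qed

text \<open>
  Conservation removes the stiff term from the moment equations already for positive \<open>\<epsilon>\<close>.
\<close>

lemma imex_step_moments:
  fixes wt :: "real Matrix.vec"
  assumes step: "imex_step \<Omega> \<iota> Q \<nu> At wt A w \<Delta>t \<epsilon> fn F fnew" and x: "x \<in> \<Omega>"
    and Q: "collision_operator D Q" and "fn x \<in> D" and F: "\<And>i. i < \<nu> \<Longrightarrow> F i x \<in> D"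
    and tr: "\<And>i. i < \<nu> \<Longrightarrow> has_moments (transport \<iota> (F i) x)"
  shows "i < \<nu> \<Longrightarrow> moments (F i x)
           = moments (fn x) + \<Delta>t *\<^sub>R (\<Sum>j<\<nu>. At $$ (i, j) *\<^sub>R moments (transport \<iota> (F j) x))"
    and "moments (fnew x)
           = moments (fn x) + \<Delta>t *\<^sub>R (\<Sum>j<\<nu>. wt $ j *\<^sub>R moments (transport \<iota> (F j) x))"
proof -
  have fn: "has_moments (fn x)"
    using Q \<open>fn x \<in> D\<close> by (auto simp: collision_operator_def admissible_def)
  have q: "has_moments (Q (F j x)) \<and> moments (Q (F j x)) = 0" if "j < \<nu>" for j
    using Q F[OF that] by (auto simp: collision_operator_def)
  have Fi: "F i x = (\<lambda>v. fn x v + \<Delta>t * (\<Sum>j<\<nu>. At $$ (i, j) * transport \<iota> (F j) x v)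
                  + \<Delta>t / \<epsilon> * (\<Sum>j<\<nu>. A $$ (i, j) * Q (F j x) v))" if "i < \<nu>"
    using step x that by (auto simp: imex_step_def)
  have new: "fnew x = (\<lambda>v. fn x v + \<Delta>t * (\<Sum>j<\<nu>. wt $ j * transport \<iota> (F j) x v)
                  + \<Delta>t / \<epsilon> * (\<Sum>j<\<nu>. w $ j * Q (F j x) v))"
    using step x by (auto simp: imex_step_def)
  show "moments (F i x)
           = moments (fn x) + \<Delta>t *\<^sub>R (\<Sum>j<\<nu>. At $$ (i, j) *\<^sub>R moments (transport \<iota> (F j) x))" if "i < \<nu>"
    unfolding arg_cong[OF Fi[OF that], of moments]
    by (rule moments_imex_combination) (use fn tr q in auto)
  show "moments (fnew x)
           = moments (fn x) + \<Delta>t *\<^sub>R (\<Sum>j<\<nu>. wt $ j *\<^sub>R moments (transport \<iota> (F j) x))"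
    unfolding arg_cong[OF new, of moments]
    by (rule moments_imex_combination) (use fn tr q in auto)
qed

text \<open>
  Multiplying the equation by \<open>\<epsilon>\<close> shows that the factor of \<open>1/\<epsilon>\<close> must tend to zero when all
  other terms converge.
\<close>

lemma stiff_term_limit_eq_0:
  fixes F f L :: "real \<Rightarrow> real"
  assumes F: "(F \<longlongrightarrow> F0) (at_right 0)" and f: "(f \<longlongrightarrow> f0) (at_right 0)"
    and L: "(L \<longlongrightarrow> L0) (at_right 0)" and S: "(S \<longlongrightarrow> S0) (at_right 0)"
    and "c \<noteq> 0"
    and eq: "\<And>\<epsilon>. \<epsilon> > 0 \<Longrightarrow> F \<epsilon> = f \<epsilon> + L \<epsilon> + c / \<epsilon> * S \<epsilon>"
  shows "S0 = 0"
proof -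
  have "((\<lambda>\<epsilon>. \<epsilon> / c * (F \<epsilon> - f \<epsilon> - L \<epsilon>)) \<longlongrightarrow> 0 / c * (F0 - f0 - L0)) (at_right 0)"
    by (intro tendsto_intros F f L \<open>c \<noteq> 0\<close>)
  moreover have "\<forall>\<^sub>F \<epsilon> in at_right 0. \<epsilon> / c * (F \<epsilon> - f \<epsilon> - L \<epsilon>) = S \<epsilon>"
    using eventually_at_right_less[of "0::real"]
    by eventually_elim (use \<open>c \<noteq> 0\<close> in \<open>simp add: eq\<close>)
  ultimately have "(S \<longlongrightarrow> 0) (at_right 0)"
    by (simp add: tendsto_cong)
  then show ?thesis
    using S tendsto_unique trivial_limit_at_right_real by blast
qed

lemma kinetic_limit_eqI:
  assumes "kinetic_limit \<Omega> g g0" and "kinetic_limit \<Omega> h h0"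
    and "\<And>\<epsilon> v. \<epsilon> > 0 \<Longrightarrow> g \<epsilon> x v = h \<epsilon> x v" and "x \<in> \<Omega>"
  shows "g0 x = h0 x"
proof
  fix v
  have "\<forall>\<^sub>F \<epsilon> in at_right 0. h \<epsilon> x v = g \<epsilon> x v"
    using eventually_at_right_less[of "0::real"] by eventually_elim (simp add: assms(3))
  then have "((\<lambda>\<epsilon>. g \<epsilon> x v) \<longlongrightarrow> h0 x v) (at_right 0)"
    using assms(2,4) unfolding kinetic_limit_def by (blast intro: Lim_transform_eventually)
  then show "g0 x v = h0 x v"
    using assms(1,4) tendsto_unique trivial_limit_at_right_real
    unfolding kinetic_limit_def by blast
qed

section \<open>The limit scheme\<close>

theorem theorem3p6:
  fixes \<Omega> :: "(real ^ 'd::finite) set"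
    and \<iota> :: "'d \<Rightarrow> 3"
    and D :: "(real ^ 3 \<Rightarrow> real) set"
    and Q :: "(real ^ 3 \<Rightarrow> real) \<Rightarrow> real ^ 3 \<Rightarrow> real"
    and \<nu> :: nat
    and At A :: "real mat"
    and wt w :: "real Matrix.vec"
    and \<Delta>t :: real
    and f0 :: "real \<Rightarrow> real ^ 'd \<Rightarrow> real ^ 3 \<Rightarrow> real"
    and f :: "real \<Rightarrow> nat \<Rightarrow> real ^ 'd \<Rightarrow> real ^ 3 \<Rightarrow> real"
    and F :: "real \<Rightarrow> nat \<Rightarrow> nat \<Rightarrow> real ^ 'd \<Rightarrow> real ^ 3 \<Rightarrow> real"
    and flim :: "nat \<Rightarrow> real ^ 'd \<Rightarrow> real ^ 3 \<Rightarrow> real"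
    and Flim :: "nat \<Rightarrow> nat \<Rightarrow> real ^ 'd \<Rightarrow> real ^ 3 \<Rightarrow> real"
  assumes "open \<Omega>" and "inj \<iota>"
    and "collision_operator D Q"
    and "imex_tableau \<nu> At wt A w"
    and "type_CK \<nu> A"
    and "globally_stiffly_accurate \<nu> At wt A w"
    and "\<Delta>t > 0"
    and "consistent_initial_data \<Omega> f0"
    and "\<And>\<epsilon> x v. \<epsilon> > 0 \<Longrightarrow> x \<in> \<Omega> \<Longrightarrow> f \<epsilon> 0 x v = f0 \<epsilon> x v"
    and "\<And>\<epsilon> n. \<epsilon> > 0 \<Longrightarrow>
           imex_step \<Omega> \<iota> Q \<nu> At wt A w \<Delta>t \<epsilon> (f \<epsilon> n) (F \<epsilon> n) (f \<epsilon> (Suc n))"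
    \<comment> \<open>all numerical quantities and their limits are distributions on which the operators act\<close>
    and "\<And>\<epsilon> n x. \<epsilon> > 0 \<Longrightarrow> x \<in> \<Omega> \<Longrightarrow> f \<epsilon> n x \<in> D"
    and "\<And>\<epsilon> n i x. \<epsilon> > 0 \<Longrightarrow> i < \<nu> \<Longrightarrow> x \<in> \<Omega> \<Longrightarrow> F \<epsilon> n i x \<in> D"
    and "\<And>\<epsilon> n i. \<epsilon> > 0 \<Longrightarrow> i < \<nu> \<Longrightarrow> transportable \<Omega> \<iota> (F \<epsilon> n i)"
    and "\<And>n x. x \<in> \<Omega> \<Longrightarrow> flim n x \<in> D"
    and "\<And>n i x. i < \<nu> \<Longrightarrow> x \<in> \<Omega> \<Longrightarrow> Flim n i x \<in> D"
    and "\<And>n i. i < \<nu> \<Longrightarrow> transportable \<Omega> \<iota> (Flim n i)"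
    \<comment> \<open>convergence, and commutation of the operators with the limit\<close>
    and "\<And>n. kinetic_limit \<Omega> (\<lambda>\<epsilon>. f \<epsilon> n) (flim n)"
    and "\<And>n i. i < \<nu> \<Longrightarrow> kinetic_limit \<Omega> (\<lambda>\<epsilon>. F \<epsilon> n i) (Flim n i)"
    and "\<And>n i. i < \<nu> \<Longrightarrow>
           kinetic_limit \<Omega> (\<lambda>\<epsilon> x. Q (F \<epsilon> n i x)) (\<lambda>x. Q (Flim n i x))"
    and "\<And>n i. i < \<nu> \<Longrightarrow>
           kinetic_limit \<Omega> (\<lambda>\<epsilon>. transport \<iota> (F \<epsilon> n i)) (transport \<iota> (Flim n i))"
    and "\<And>n. kinetic_limit \<Omega> (\<lambda>\<epsilon> x. maxwellian (f \<epsilon> n x)) (\<lambda>x. maxwellian (flim n x))"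
    and "\<And>n i. i < \<nu> \<Longrightarrow>
           kinetic_limit \<Omega> (\<lambda>\<epsilon> x. maxwellian (F \<epsilon> n i x)) (\<lambda>x. maxwellian (Flim n i x))"
    and "\<And>n. moment_limit \<Omega> (\<lambda>\<epsilon>. f \<epsilon> n) (flim n)"
    and "\<And>n i. i < \<nu> \<Longrightarrow> moment_limit \<Omega> (\<lambda>\<epsilon>. F \<epsilon> n i) (Flim n i)"
    and "\<And>n i. i < \<nu> \<Longrightarrow>
           moment_limit \<Omega> (\<lambda>\<epsilon>. transport \<iota> (F \<epsilon> n i)) (transport \<iota> (Flim n i))"
  shows "\<forall>n. (\<forall>i<\<nu>. \<forall>x\<in>\<Omega>. Flim n i x = maxwellian (Flim n i x)) \<and>
             explicit_euler_step \<Omega> \<iota> \<nu> At wt \<Delta>t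
               (\<lambda>x. moments (flim n x)) (\<lambda>i x. moments (Flim n i x))
               (\<lambda>x. moments (flim (Suc n) x))"
proof -
  have \<nu>0: "\<nu> > 0" and Ac: "A \<in> carrier_mat \<nu> \<nu>"
    and A0: "\<And>j. j < \<nu> \<Longrightarrow> A $$ (0, j) = 0"
    and At0: "\<And>i j. i < \<nu> \<Longrightarrow> j < \<nu> \<Longrightarrow> j \<ge> i \<Longrightarrow> At $$ (i, j) = 0"
    using assms(4,5) type_CK_first_row[of A \<nu>] by (auto simp: imex_tableau_def)
  have equilibrium: "(\<forall>v. Q g v = 0) \<longleftrightarrow> g = maxwellian g" if "g \<in> D" for g
    using assms(3) that by (auto simp: collision_operator_def)
  have klim: "\<And>n x v. x \<in> \<Omega> \<Longrightarrow> ((\<lambda>\<epsilon>. f \<epsilon> n x v) \<longlongrightarrow> flim n x v) (at_right 0)"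
    "\<And>n i x v. i < \<nu> \<Longrightarrow> x \<in> \<Omega> \<Longrightarrow> ((\<lambda>\<epsilon>. F \<epsilon> n i x v) \<longlongrightarrow> Flim n i x v) (at_right 0)"
    "\<And>n i x v. i < \<nu> \<Longrightarrow> x \<in> \<Omega> \<Longrightarrow>
       ((\<lambda>\<epsilon>. Q (F \<epsilon> n i x) v) \<longlongrightarrow> Q (Flim n i x) v) (at_right 0)"
    "\<And>n i x v. i < \<nu> \<Longrightarrow> x \<in> \<Omega> \<Longrightarrow>
       ((\<lambda>\<epsilon>. transport \<iota> (F \<epsilon> n i) x v) \<longlongrightarrow> transport \<iota> (Flim n i) x v) (at_right 0)"
    using assms(17-20) by (auto simp: kinetic_limit_def)

  \<comment> \<open>the first rows of both tableaux vanish, so the first stage is the old value\<close>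
  have first_stage: "Flim n 0 x = flim n x" if "x \<in> \<Omega>" for n x
  proof (rule kinetic_limit_eqI[OF assms(18)[OF \<nu>0] assms(17) _ that])
    show "F \<epsilon> n 0 x v = f \<epsilon> n x v" if "\<epsilon> > 0" for \<epsilon> v
      using assms(10)[OF that, of n] \<open>x \<in> \<Omega>\<close> \<nu>0 A0 At0[OF \<nu>0] by (auto simp: imex_step_def)
  qed

  \<comment> \<open>stiff accuracy makes the new value the last stage, which carries equilibrium to the next step\<close>
  have last_stage: "flim (Suc n) x = Flim n (\<nu> - 1) x" if "x \<in> \<Omega>" for n x
  proof (rule kinetic_limit_eqI[OF assms(17) assms(18) _ that])
    have w: "w $ j = A $$ (\<nu> - 1, j)" "wt $ j = At $$ (\<nu> - 1, j)" if "j < \<nu>" for j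
      using assms(6) that by (auto simp: globally_stiffly_accurate_def)
    show "f \<epsilon> (Suc n) x v = F \<epsilon> n (\<nu> - 1) x v" if "\<epsilon> > 0" for \<epsilon> v
      using assms(10)[OF that, of n] \<open>x \<in> \<Omega>\<close> \<nu>0 w by (auto simp: imex_step_def)
  qed (use \<nu>0 in simp)

  have collision_sum: "(\<Sum>j<\<nu>. A $$ (i, j) * Q (Flim n j x) v) = 0"
    if "i < \<nu>" "x \<in> \<Omega>" for n i x v
  proof (rule stiff_term_limit_eq_0)
    show "((\<lambda>\<epsilon>. F \<epsilon> n i x v) \<longlongrightarrow> Flim n i x v) (at_right 0)"
      and "((\<lambda>\<epsilon>. f \<epsilon> n x v) \<longlongrightarrow> flim n x v) (at_right 0)"
      using klim that by blast+
    show "((\<lambda>\<epsilon>. \<Delta>t * (\<Sum>j<\<nu>. At $$ (i, j) * transport \<iota> (F \<epsilon> n j) x v)) \<longlongrightarrow>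
        \<Delta>t * (\<Sum>j<\<nu>. At $$ (i, j) * transport \<iota> (Flim n j) x v)) (at_right 0)"
      using that by (intro tendsto_intros klim) auto
    show "((\<lambda>\<epsilon>. \<Sum>j<\<nu>. A $$ (i, j) * Q (F \<epsilon> n j x) v) \<longlongrightarrow>
        (\<Sum>j<\<nu>. A $$ (i, j) * Q (Flim n j x) v)) (at_right 0)"
      using that by (intro tendsto_intros klim) auto
    show "F \<epsilon> n i x v = f \<epsilon> n x v + \<Delta>t * (\<Sum>j<\<nu>. At $$ (i, j) * transport \<iota> (F \<epsilon> n j) x v)
        + \<Delta>t / \<epsilon> * (\<Sum>j<\<nu>. A $$ (i, j) * Q (F \<epsilon> n j x) v)" if "\<epsilon> > 0" for \<epsilon>
      using assms(10)[OF that, of n] \<open>i < \<nu>\<close> \<open>x \<in> \<Omega>\<close> by (simp add: imex_step_def)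
  qed (use assms(7) in simp)

  have stages: "Flim n i x = maxwellian (Flim n i x)"
    if "flim n x = maxwellian (flim n x)" "i < \<nu>" "x \<in> \<Omega>" for n i x
  proof -
    have "Q (Flim n i x) v = 0" for v
    proof (rule type_CK_kernel[OF Ac assms(5), where q = "\<lambda>j. Q (Flim n j x) v"])
      show "Q (Flim n 0 x) v = 0"
        using that equilibrium[OF assms(14), of x n] first_stage[of x n] by simp
    qed (use collision_sum that in auto)
    then show ?thesis
      using equilibrium[OF assms(15)] that by blast
  qed

  have steps: "\<forall>x\<in>\<Omega>. flim n x = maxwellian (flim n x)" for n
  proof (induction n)
    case 0
    show ?case
    proof
      fix x assume x: "x \<in> \<Omega>"
      obtain g where g: "\<And>\<epsilon> v. \<epsilon> > 0 \<Longrightarrow> f0 \<epsilon> x v = maxwellian (f0 \<epsilon> x) v + g \<epsilon> x v"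
        and g0: "\<And>v. ((\<lambda>\<epsilon>. g \<epsilon> x v) \<longlongrightarrow> 0) (at_right 0)"
        using assms(8) x unfolding consistent_initial_data_def by blast
      have f0: "f \<epsilon> 0 x = f0 \<epsilon> x" if "\<epsilon> > 0" for \<epsilon>
        using assms(9) that x by blast
      show "flim 0 x = maxwellian (flim 0 x)"
      proof (rule ext)
        fix v
        have "((\<lambda>\<epsilon>. maxwellian (f \<epsilon> 0 x) v + g \<epsilon> x v) \<longlongrightarrow> maxwellian (flim 0 x) v + 0) (at_right 0)"
          using assms(21)[of 0] x by (intro tendsto_add g0) (auto simp: kinetic_limit_def)
        moreover have "\<forall>\<^sub>F \<epsilon> in at_right 0. maxwellian (f \<epsilon> 0 x) v + g \<epsilon> x v = f \<epsilon> 0 x v"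
          using eventually_at_right_less[of "0::real"]
          by eventually_elim (simp add: f0 g[symmetric])
        ultimately have "((\<lambda>\<epsilon>. f \<epsilon> 0 x v) \<longlongrightarrow> maxwellian (flim 0 x) v) (at_right 0)"
          by (simp add: tendsto_cong)
        then show "flim 0 x v = maxwellian (flim 0 x) v"
          using klim(1)[OF x] tendsto_unique trivial_limit_at_right_real by blast
      qed
    qed
  next
    case (Suc n)
    then show ?case
      using stages[of n _ "\<nu> - 1"] \<nu>0 by (simp add: last_stage)
  qed

  have F_maxw: "Flim n i x = maxwellian (Flim n i x)" if "i < \<nu>" "x \<in> \<Omega>" for n i x
    using stages steps that by blast

  have D_adm: "D \<subseteq> admissible" using assms(3) by (simp add: collision_operator_def)
  have flux: "flux_differentiable \<iota> (\<lambda>y. moments (Flim n i y)) x"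
    "moments (transport \<iota> (Flim n i) x) = - div_flux \<iota> (\<lambda>y. moments (Flim n i y)) x"
    if "i < \<nu>" "x \<in> \<Omega>" for n i x
    by (rule moments_transport_maxwellian[OF assms(1) that(2)];
        use assms(15,16) D_adm F_maxw that in \<open>auto simp: transportable_def\<close>)+

  have mlim: "((\<lambda>\<epsilon>. moments (f \<epsilon> n x)) \<longlongrightarrow> moments (flim n x)) (at_right 0)"
    "i < \<nu> \<Longrightarrow> ((\<lambda>\<epsilon>. moments (F \<epsilon> n i x)) \<longlongrightarrow> moments (Flim n i x)) (at_right 0)"
    "i < \<nu> \<Longrightarrow> ((\<lambda>\<epsilon>. moments (transport \<iota> (F \<epsilon> n i) x)) \<longlongrightarrow>
        - div_flux \<iota> (\<lambda>y. moments (Flim n i y)) x) (at_right 0)" if "x \<in> \<Omega>" for n i x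
    using assms(23-25) that by (auto simp: moment_limit_def flux(2)[of i x n, symmetric])

  have limit_balance: "M0 = moments (flim n x)
        - \<Delta>t *\<^sub>R (\<Sum>j<\<nu>. b j *\<^sub>R div_flux \<iota> (\<lambda>y. moments (Flim n j y)) x)"
    if x: "x \<in> \<Omega>" and M: "(M \<longlongrightarrow> M0) (at_right 0)"
      and eq: "\<And>\<epsilon>. \<epsilon> > 0 \<Longrightarrow> M \<epsilon> = moments (f \<epsilon> n x)
        + \<Delta>t *\<^sub>R (\<Sum>j<\<nu>. b j *\<^sub>R moments (transport \<iota> (F \<epsilon> n j) x))" for M M0 n x b
  proof -
    have "((\<lambda>\<epsilon>. moments (f \<epsilon> n x)
        + \<Delta>t *\<^sub>R (\<Sum>j<\<nu>. b j *\<^sub>R moments (transport \<iota> (F \<epsilon> n j) x))) \<longlongrightarrow>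
        moments (flim n x)
        + \<Delta>t *\<^sub>R (\<Sum>j<\<nu>. b j *\<^sub>R (- div_flux \<iota> (\<lambda>y. moments (Flim n j y)) x))) (at_right 0)"
      by (intro tendsto_intros mlim x) auto
    moreover have "\<forall>\<^sub>F \<epsilon> in at_right 0. moments (f \<epsilon> n x)
        + \<Delta>t *\<^sub>R (\<Sum>j<\<nu>. b j *\<^sub>R moments (transport \<iota> (F \<epsilon> n j) x)) = M \<epsilon>"
      using eventually_at_right_less[of "0::real"] by eventually_elim (simp add: eq)
    ultimately have "(M \<longlongrightarrow> moments (flim n x)
        + \<Delta>t *\<^sub>R (\<Sum>j<\<nu>. b j *\<^sub>R (- div_flux \<iota> (\<lambda>y. moments (Flim n j y)) x))) (at_right 0)"
      using tendsto_cong by fast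
    then have "M0 = moments (flim n x)
        + \<Delta>t *\<^sub>R (\<Sum>j<\<nu>. b j *\<^sub>R (- div_flux \<iota> (\<lambda>y. moments (Flim n j y)) x))"
      using M tendsto_unique trivial_limit_at_right_real by blast
    then show ?thesis by (simp add: sum_negf)
  qed
  have balance: "i < \<nu> \<Longrightarrow> moments (F \<epsilon> n i x) = moments (f \<epsilon> n x)
        + \<Delta>t *\<^sub>R (\<Sum>j<\<nu>. At $$ (i, j) *\<^sub>R moments (transport \<iota> (F \<epsilon> n j) x))"
    "moments (f \<epsilon> (Suc n) x) = moments (f \<epsilon> n x)
        + \<Delta>t *\<^sub>R (\<Sum>j<\<nu>. wt $ j *\<^sub>R moments (transport \<iota> (F \<epsilon> n j) x))"
    if "\<epsilon> > 0" "x \<in> \<Omega>" for \<epsilon> n i x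
    by (rule imex_step_moments[OF assms(10)[OF that(1)] that(2) assms(3)];
        use assms(11-13) that in \<open>auto simp: transportable_def\<close>)+

  show ?thesis
    unfolding explicit_euler_step_def
  proof (intro allI conjI ballI impI)
    fix n i x assume x: "x \<in> \<Omega>" and i: "i < \<nu>"
    show "Flim n i x = maxwellian (Flim n i x)" by (rule F_maxw[OF i x])
    show "flux_differentiable \<iota> (\<lambda>y. moments (Flim n i y)) x" by (rule flux(1)[OF i x])
    have "moments (Flim n i x) = moments (flim n x)
        - \<Delta>t *\<^sub>R (\<Sum>j<\<nu>. At $$ (i, j) *\<^sub>R div_flux \<iota> (\<lambda>y. moments (Flim n j y)) x)"
      by (rule limit_balance[OF x mlim(2)[OF x i]]) (rule balance(1)[OF _ x i])
    also have "(\<Sum>j<\<nu>. At $$ (i, j) *\<^sub>R div_flux \<iota> (\<lambda>y. moments (Flim n j y)) x)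
        = (\<Sum>j<i. At $$ (i, j) *\<^sub>R div_flux \<iota> (\<lambda>y. moments (Flim n j y)) x)"
      using i At0[OF i] by (intro sum.mono_neutral_right) auto
    finally show "moments (Flim n i x) = moments (flim n x)
        - \<Delta>t *\<^sub>R (\<Sum>j<i. At $$ (i, j) *\<^sub>R div_flux \<iota> (\<lambda>y. moments (Flim n j y)) x)" .
  next
    fix n x assume x: "x \<in> \<Omega>"
    show "moments (flim (Suc n) x) = moments (flim n x)
        - \<Delta>t *\<^sub>R (\<Sum>i<\<nu>. wt $ i *\<^sub>R div_flux \<iota> (\<lambda>y. moments (Flim n i y)) x)"
      by (rule limit_balance[OF x mlim(1)[OF x]]) (rule balance(2)[OF _ x])
  qed
qed

end
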